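(* Let $p\ge2$ be an integer, $q=e^{i\pi/p}$, and let $\mathscr D$ be the algebra of quantum differential operators on the divided-power quantum plane $A=\underline{\mathbb C}_q[x,y]$, i.e. the linear span of $x^{(m)}y^{(n)}\partial_x^a\partial_y^b$ with $m,n,a,b\ge0$. The relations in $\mathscr D$ are compatible with a $U$-module algebra structure, $U=\overline{\mathcal U}_qs\ell(2)$, if, in addition to the given action of $U$ on the elements $x^{(m)}y^{(n)}\in A$, the action is defined by $$E\,\partial_x=-q\,\partial_y,\quad E\,\partial_y=0,\qquad K\,\partial_x=q^{-1}\partial_x,\quad K\,\partial_y=q\,\partial_y,\qquad F\,\partial_x=0,\quad F\,\partial_y=-q^{-1}\partial_x.$$ That is, these formulas together with the action on $A$ extend, by the rule $h(uv)=\sum(h'u)(h''v)$ for $h\in U$, to a well-defined $U$-module algebra structure on $\mathscr D$.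
   Context: Notation: $[n]=\frac{q^n-q^{-n}}{q-q^{-1}}$, $[n]!=[1][2]\cdots[n]$, and $\left[{m\atop n}\right]$ is the $q$-binomial coefficient $\frac{[m]!}{[m-n]!\,[n]!}$, understood as the value at $q=e^{i\pi/p}$ of the corresponding Laurent polynomial in a generic parameter. Quantum group $U=\overline{\mathcal U}_{q}s\ell(2)$: the $\mathbb C$-algebra generated by $E,F,K^{\pm1}$ with relations $KEK^{-1}=q^2E$, $KFK^{-1}=q^{-2}F$, $[E,F]=\frac{K-K^{-1}}{q-q^{-1}}$, $E^p=F^p=0$, $K^{2p}=1$, with Hopf algebra structure $\Delta(E)=E\otimes K+1\otimes E$, $\Delta(K)=K\otimes K$, $\Delta(F)=F\otimes1+K^{-1}\otimes F$, $\epsilon(E)=\epsilon(F)=0$, $\epsilon(K)=1$, $S(E)=-EK^{-1}$, $S(K)=K^{-1}$, $S(F)=-KF$. A $U$-module algebra is an associative algebra with a $U$-action such that $h(uv)=\sum(h'u)(h''v)$ where $\Delta(h)=\sum h'\otimes h''$, and $h(1)=\epsilon(h)1$. Divided-power quantum plane $A=\underline{\mathbb C}_q[x,y]$: the associative algebra with basis $x^{(m)}y^{(n)}$, $m,n\ge0$ ($x^{(0)}=y^{(0)}=1$, $x=x^{(1)}$, $y=y^{(1)}$), and multiplication determined by $x^{(m)}x^{(n)}=\left[{m+n\atop m}\right]x^{(m+n)}$, $y^{(m)}y^{(n)}=\left[{m+n\atop m}\right]y^{(m+n)}$, $y^{(n)}x^{(m)}=q^{nm}x^{(m)}y^{(n)}$;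 $x^{(m)}=y^{(m)}=0$ for $m<0$. It is a $U$-module algebra with $E(x^{(m)}y^{(n)})=[m+1]x^{(m+1)}y^{(n-1)}$, $K(x^{(m)}y^{(n)})=q^{m-n}x^{(m)}y^{(n)}$, $F(x^{(m)}y^{(n)})=[n+1]x^{(m-1)}y^{(n+1)}$. Quantum derivatives $\partial_x,\partial_y:A\to A$ are the linear maps $\partial_x(x^{(m)}y^{(n)})=q^{-m-2n+1}x^{(m-1)}y^{(n)}$, $\partial_y(x^{(m)}y^{(n)})=q^{-m-n+1}x^{(m)}y^{(n-1)}$. $\mathscr D$ is the linear span of the operators $x^{(m)}y^{(n)}\partial_x^a\partial_y^b$ on $A$ (elements of $A$ acting by left multiplication), with multiplication being composition. Its relations are those of $A$, together with $\partial_x\partial_y=q\,\partial_y\partial_x$ and $\partial_x\,x^{(m)}y^{(n)}=q^{-2m-n}x^{(m)}y^{(n)}\partial_x+q^{-m-2n+1}x^{(m-1)}y^{(n)}+q^{-m-2n-1}(1-q^2)[n+1]\,x^{(m-1)}y^{(n+1)}\partial_y$, $\partial_y\,x^{(m)}y^{(n)}=q^{-m-2n}x^{(m)}y^{(n)}\partial_y+q^{-m-n+1}x^{(m)}y^{(n-1)}$ for all $m,n\ge0$ (and the consequences of these for powers $\partial_x^\ell,\partial_y^\ell$). *)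

theory Defs
  imports
    Complex_Main
    "HOL-Library.Poly_Mapping"
    "HOL-Library.Product_Plus"
    "HOL-Library.Function_Algebras"
    "HOL-Algebra.QuotRing"
begin

section \<open>$q$-numbers\<close>

definition qpar :: "nat \<Rightarrow> complex"
  where "qpar p = exp (\<i> * of_real pi / of_nat p)"

definition qnum :: "nat \<Rightarrow> nat \<Rightarrow> complex"
  where "qnum p n = (qpar p ^ n - inverse (qpar p) ^ n) / (qpar p - inverse (qpar p))"

text \<open>
  Since $[p] = 0$ at $q = e^{i\pi/p}$, the $q$-binomial coefficient is formed in the ring of Laurent
  polynomials in a generic parameter $v$ (an integral domain) and only then evaluated at $q$.
\<close>

type_synonym laurent = "int \<Rightarrow>\<^sub>0 complex"

definition lvar :: "int \<Rightarrow> laurent"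
  where "lvar k = Poly_Mapping.single k 1"

definition lquot :: "laurent \<Rightarrow> laurent \<Rightarrow> laurent"
  where "lquot a b = (THE c. c * b = a)"

definition lnum :: "nat \<Rightarrow> laurent"
  where "lnum n = lquot (lvar (int n) - lvar (- int n)) (lvar 1 - lvar (-1))"

definition lfact :: "nat \<Rightarrow> laurent"
  where "lfact n = (\<Prod>i=1..n. lnum i)"

definition lbinom :: "nat \<Rightarrow> nat \<Rightarrow> laurent"
  where "lbinom m n = lquot (lfact m) (lfact (m - n) * lfact n)"

definition leval :: "complex \<Rightarrow> laurent \<Rightarrow> complex"
  where "leval z f = (\<Sum>k\<in>Poly_Mapping.keys f. Poly_Mapping.lookup f k * z powi k)"

definition qbinom :: "nat \<Rightarrow> nat \<Rightarrow> nat \<Rightarrow> complex"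
  where "qbinom p m n = leval (qpar p) (lbinom m n)"


section \<open>The quantum group $U$\<close>

subsection \<open>Free algebra and its tensor square\<close>

text \<open>
  With concatenation as addition, lists form a monoid. The convolution product of finitely
  supported functions then makes \<open>gen list \<Rightarrow>\<^sub>0 complex\<close> the free
  algebra on \<open>gen\<close>, and \<open>gen list \<times> gen list \<Rightarrow>\<^sub>0 complex\<close>
  its tensor square, where the basis vector at \<open>(v, w)\<close> is $v \otimes w$.
\<close>

instantiation list :: (type) monoid_add
begin

definition zero_list_def: "0 = []"
definition plus_list_def: "xs + ys = xs @ ys"

instance
  by standard (simp_all add: zero_list_def plus_list_def)

end

datatype gen = GE | GF | GK | GKinv

type_synonym free = "gen list \<Rightarrow>\<^sub>0 complex"
type_synonym free2 = "(gen list \<times> gen list) \<Rightarrow>\<^sub>0 complex"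

definition scalar :: "complex \<Rightarrow> 'k::monoid_add \<Rightarrow>\<^sub>0 complex"
  where "scalar c = Poly_Mapping.single 0 c"

definition letter :: "gen \<Rightarrow> free"
  where "letter g = Poly_Mapping.single [g] 1"

abbreviation fE :: free where "fE \<equiv> letter GE"
abbreviation fF :: free where "fF \<equiv> letter GF"
abbreviation fK :: free where "fK \<equiv> letter GK"
abbreviation fKinv :: free where "fKinv \<equiv> letter GKinv"

definition tensor :: "free \<Rightarrow> free \<Rightarrow> free2"
  where "tensor f g = (\<Sum>v\<in>Poly_Mapping.keys f. \<Sum>w\<in>Poly_Mapping.keys g.
           Poly_Mapping.single (v, w) (Poly_Mapping.lookup f v * Poly_Mapping.lookup g w))"

text \<open>The algebra homomorphism out of the free algebra with given values on the generators;
  \<open>emb\<close> embeds the scalars into the target.\<close>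

definition free_extend :: "(complex \<Rightarrow> 'b) \<Rightarrow> (gen \<Rightarrow> 'b) \<Rightarrow> free \<Rightarrow> 'b::ring_1"
  where "free_extend emb \<phi> f =
           (\<Sum>w\<in>Poly_Mapping.keys f. emb (Poly_Mapping.lookup f w) * prod_list (map \<phi> w))"

definition as_ring :: "'a::ring_1 ring"
  where "as_ring = \<lparr>carrier = UNIV, monoid.mult = (*), one = 1, ring.zero = 0, add = (+)\<rparr>"

subsection \<open>$U$ by generators and relations\<close>

definition relators :: "nat \<Rightarrow> free set"
  where "relators p = (let q = qpar p in
    {fK * fKinv - 1,
     fKinv * fK - 1,
     fK * fE * fKinv - scalar (q ^ 2) * fE,
     fK * fF * fKinv - scalar (inverse q ^ 2) * fF,
     fE * fF - fF * fE - scalar (1 / (q - inverse q)) * (fK - fKinv),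
     fE ^ p,
     fF ^ p,
     fK ^ (2 * p) - 1})"

definition U_ideal :: "nat \<Rightarrow> free set"
  where "U_ideal p = Idl\<^bsub>as_ring\<^esub> (relators p)"

definition U :: "nat \<Rightarrow> free set ring"
  where "U p = as_ring Quot (U_ideal p)"

definition U_class :: "nat \<Rightarrow> free \<Rightarrow> free set"
  where "U_class p f = U_ideal p +>\<^bsub>as_ring\<^esub> f"

definition UU_ideal :: "nat \<Rightarrow> free2 set"
  where "UU_ideal p = Idl\<^bsub>as_ring\<^esub>
           ((\<lambda>r. tensor r 1) ` relators p \<union> (\<lambda>r. tensor 1 r) ` relators p)"

subsection \<open>Coproduct and counit\<close>

definition free_comult :: "free \<Rightarrow> free2"
  where "free_comult = free_extend scalar (\<lambda>g. case g of
      GE \<Rightarrow> tensor fE fK + tensor 1 fE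
    | GF \<Rightarrow> tensor fF 1 + tensor fKinv fF
    | GK \<Rightarrow> tensor fK fK
    | GKinv \<Rightarrow> tensor fKinv fKinv)"

definition free_counit :: "free \<Rightarrow> complex"
  where "free_counit = free_extend id (\<lambda>g. case g of GE \<Rightarrow> 0 | GF \<Rightarrow> 0 | GK \<Rightarrow> 1 | GKinv \<Rightarrow> 1)"

text \<open>The coproduct of \<open>h\<close> as a coset in $U \otimes U$, that is, modulo \<open>UU_ideal\<close>. As usual for
  maps on quotients, the union is over the representatives of \<open>h\<close>, all of which give the same
  coset.\<close>

definition comult :: "nat \<Rightarrow> free set \<Rightarrow> free2 set"
  where "comult p h = (\<Union>f\<in>h. UU_ideal p +>\<^bsub>as_ring\<^esub> free_comult f)"

subsection \<open>Module algebras over $U$\<close>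

text \<open>
  An associative unital algebra on the subspace \<open>M\<close> of a complex vector space, with an action
  of \<open>U p\<close>. In \<open>act_mult\<close>, a representative \<open>t\<close> of $\Delta(h)$ yields the Sweedler
  decomposition $\Delta(h) = \sum t_{v,w}\, [v] \otimes [w]$ over pairs of words.
\<close>

locale U_module_algebra = vector_space scale
  for scale :: "complex \<Rightarrow> 'v::ab_group_add \<Rightarrow> 'v" +
  fixes p :: nat
    and M :: "'v set"
    and mul :: "'v \<Rightarrow> 'v \<Rightarrow> 'v"
    and unit :: 'v
    and act :: "free set \<Rightarrow> 'v \<Rightarrow> 'v"
  assumes carrier_subspace: "subspace M"
    and mul_closed: "\<lbrakk>u \<in> M; v \<in> M\<rbrakk> \<Longrightarrow> mul u v \<in> M"
    and unit_closed: "unit \<in> M"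
    and mul_assoc: "\<lbrakk>u \<in> M; v \<in> M; w \<in> M\<rbrakk> \<Longrightarrow> mul (mul u v) w = mul u (mul v w)"
    and mul_unit_left: "u \<in> M \<Longrightarrow> mul unit u = u"
    and mul_unit_right: "u \<in> M \<Longrightarrow> mul u unit = u"
    and mul_add_left: "\<lbrakk>u \<in> M; v \<in> M; w \<in> M\<rbrakk> \<Longrightarrow> mul (u + v) w = mul u w + mul v w"
    and mul_add_right: "\<lbrakk>u \<in> M; v \<in> M; w \<in> M\<rbrakk> \<Longrightarrow> mul u (v + w) = mul u v + mul u w"
    and mul_scale_left: "\<lbrakk>u \<in> M; v \<in> M\<rbrakk> \<Longrightarrow> mul (scale c u) v = scale c (mul u v)"
    and mul_scale_right: "\<lbrakk>u \<in> M; v \<in> M\<rbrakk> \<Longrightarrow> mul u (scale c v) = scale c (mul u v)"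
    and act_closed: "\<lbrakk>h \<in> carrier (U p); u \<in> M\<rbrakk> \<Longrightarrow> act h u \<in> M"
    and act_add_right: "\<lbrakk>h \<in> carrier (U p); u \<in> M; v \<in> M\<rbrakk> \<Longrightarrow> act h (u + v) = act h u + act h v"
    and act_scale_right: "\<lbrakk>h \<in> carrier (U p); u \<in> M\<rbrakk> \<Longrightarrow> act h (scale c u) = scale c (act h u)"
    and act_add_left: "\<lbrakk>g \<in> carrier (U p); h \<in> carrier (U p); u \<in> M\<rbrakk>
          \<Longrightarrow> act (g \<oplus>\<^bsub>U p\<^esub> h) u = act g u + act h u"
    and act_scalar: "u \<in> M \<Longrightarrow> act (U_class p (scalar c)) u = scale c u"
    and act_times: "\<lbrakk>g \<in> carrier (U p); h \<in> carrier (U p); u \<in> M\<rbrakk>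
          \<Longrightarrow> act (g \<otimes>\<^bsub>U p\<^esub> h) u = act g (act h u)"
    and act_mult: "\<lbrakk>h \<in> carrier (U p); t \<in> comult p h; u \<in> M; v \<in> M\<rbrakk>
          \<Longrightarrow> act h (mul u v) =
             (\<Sum>(a, b)\<in>Poly_Mapping.keys t. scale (Poly_Mapping.lookup t (a, b))
                (mul (act (U_class p (Poly_Mapping.single a 1)) u)
                     (act (U_class p (Poly_Mapping.single b 1)) v)))"
    and act_unit: "\<lbrakk>h \<in> carrier (U p); f \<in> h\<rbrakk> \<Longrightarrow> act h unit = scale (free_counit f) unit"


section \<open>The divided-power quantum plane\<close>

text \<open>Only the vector space structure of this type is used: the product of the quantum plane is
  \<open>qp_mult\<close> below, not the convolution product.\<close>

type_synonym qplane = "(nat \<times> nat) \<Rightarrow>\<^sub>0 complex"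

definition qp_scale :: "complex \<Rightarrow> qplane \<Rightarrow> qplane"
  where "qp_scale c = Poly_Mapping.map ((*) c)"

text \<open>\<open>mon m n\<close> is $x^{(m)}y^{(n)}$; integer exponents give the convention that it vanishes for
  negative $m$ or $n$.\<close>

definition mon :: "int \<Rightarrow> int \<Rightarrow> qplane"
  where "mon m n = (if m < 0 \<or> n < 0 then 0 else Poly_Mapping.single (nat m, nat n) 1)"

definition qp_extend :: "(nat \<Rightarrow> nat \<Rightarrow> qplane) \<Rightarrow> qplane \<Rightarrow> qplane"
  where "qp_extend \<phi> u =
           (\<Sum>(m, n)\<in>Poly_Mapping.keys u. qp_scale (Poly_Mapping.lookup u (m, n)) (\<phi> m n))"

text \<open>$x^{(m)}y^{(n)}\,x^{(r)}y^{(s)} = q^{nr}\, x^{(m)}x^{(r)}\, y^{(n)}y^{(s)}$\<close>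

definition qp_mult :: "nat \<Rightarrow> qplane \<Rightarrow> qplane \<Rightarrow> qplane"
  where "qp_mult p u v =
    qp_extend (\<lambda>m n. qp_extend (\<lambda>r s.
      qp_scale (qpar p ^ (n * r) * qbinom p (m + r) m * qbinom p (n + s) n)
        (mon (int (m + r)) (int (n + s)))) v) u"

definition qp_E :: "nat \<Rightarrow> qplane \<Rightarrow> qplane"
  where "qp_E p = qp_extend (\<lambda>m n. qp_scale (qnum p (m + 1)) (mon (int m + 1) (int n - 1)))"

definition qp_F :: "nat \<Rightarrow> qplane \<Rightarrow> qplane"
  where "qp_F p = qp_extend (\<lambda>m n. qp_scale (qnum p (n + 1)) (mon (int m - 1) (int n + 1)))"

definition qp_K :: "nat \<Rightarrow> qplane \<Rightarrow> qplane"
  where "qp_K p = qp_extend (\<lambda>m n. qp_scale (qpar p powi (int m - int n)) (mon (int m) (int n)))"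

definition dx :: "nat \<Rightarrow> qplane \<Rightarrow> qplane"
  where "dx p = qp_extend (\<lambda>m n.
           qp_scale (qpar p powi (- int m - 2 * int n + 1)) (mon (int m - 1) (int n)))"

definition dy :: "nat \<Rightarrow> qplane \<Rightarrow> qplane"
  where "dy p = qp_extend (\<lambda>m n.
           qp_scale (qpar p powi (- int m - int n + 1)) (mon (int m) (int n - 1)))"


section \<open>Quantum differential operators\<close>

type_synonym qop = "qplane \<Rightarrow> qplane"

definition op_scale :: "complex \<Rightarrow> qop \<Rightarrow> qop"
  where "op_scale c T = (\<lambda>u. qp_scale c (T u))"

interpretation qop: vector_space op_scale
proof -
  have lookup_scale: "Poly_Mapping.lookup (qp_scale c u) k = c * Poly_Mapping.lookup u k" for c u k
    by (simp add: qp_scale_def map.rep_eq when_def)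
  show "vector_space op_scale"
    by standard
      (auto simp: op_scale_def fun_eq_iff lookup_scale lookup_add algebra_simps
        intro!: poly_mapping_eqI)
qed

text \<open>Elements of the quantum plane act by left multiplication, that is, as \<open>qp_mult p a\<close>.\<close>

definition qdiff_ops :: "nat \<Rightarrow> qop set"
  where "qdiff_ops p =
    qop.span {qp_mult p (mon (int m) (int n)) \<circ> (dx p ^^ a) \<circ> (dy p ^^ b) | m n a b. True}"

definition prescribed_action :: "nat \<Rightarrow> (free set \<Rightarrow> qop \<Rightarrow> qop) \<Rightarrow> bool"
  where "prescribed_action p act \<longleftrightarrow>
    (\<forall>a. act (U_class p fE) (qp_mult p a) = qp_mult p (qp_E p a)) \<and>
    (\<forall>a. act (U_class p fF) (qp_mult p a) = qp_mult p (qp_F p a)) \<and>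
    (\<forall>a. act (U_class p fK) (qp_mult p a) = qp_mult p (qp_K p a)) \<and>
    act (U_class p fE) (dx p) = op_scale (- qpar p) (dy p) \<and>
    act (U_class p fE) (dy p) = 0 \<and>
    act (U_class p fK) (dx p) = op_scale (inverse (qpar p)) (dx p) \<and>
    act (U_class p fK) (dy p) = op_scale (qpar p) (dy p) \<and>
    act (U_class p fF) (dx p) = 0 \<and>
    act (U_class p fF) (dy p) = op_scale (- inverse (qpar p)) (dx p)"

end

theory Submission
  imports Defs
begin

text \<open>
  Every algebra of operators on a $U$-module that is stable under the adjoint action
  $h \cdot T = \sum h' \circ T \circ S(h'')$ is a $U$-module algebra. Since the quantum plane is itself a
  $U$-module algebra, the adjoint action extends the given action on left multiplications, and a
  computation on monomials shows that it has the prescribed values on $\partial_x$ and $\partial_y$.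
  The adjoint action of $E$ is a difference of two $q$-commuting nilpotent operators, so its $p$-th power
  vanishes by the $q$-binomial theorem, because $\left[{p\atop k}\right] = 0$ for $0 < k < p$; likewise for $F$.
  Uniqueness holds because multiplications, $\partial_x$ and $\partial_y$ generate the algebra.
\<close>

section \<open>Finitely supported functions\<close>

text \<open>The algebra consists of actual operators, so its relations hold automatically and the
  adjoint action is defined on all maps of the plane. Compatibility with the relations thereby
  becomes closure of the span under composition and its stability under the adjoint action. One
  obstacle is that [n]! vanishes at q for n >= p, so q-binomial identities cannot be had there by
  cancelling factorials; they are proved for Laurent polynomials and evaluated afterwards. Another
  is that U and its tensor square are quotients by ideals, and the module algebra axiom admits every
  representative of the coproduct. Independence of representatives is obtained from two-sided ideals
  of annihilating elements, in the free algebra acting on linear operators and in its tensor square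
  acting on pairs of them. The restriction to linear operators is due to the relations of U, which
  move scalars through the operator acted upon.\<close>

definition pm_sum :: "('k \<Rightarrow> 'c \<Rightarrow> 'v) \<Rightarrow> ('k \<Rightarrow>\<^sub>0 'c::zero) \<Rightarrow> 'v::comm_monoid_add"
  where "pm_sum h f = (\<Sum>k\<in>Poly_Mapping.keys f. h k (Poly_Mapping.lookup f k))"

lemma pm_sum_superset:
  assumes "finite A" "Poly_Mapping.keys f \<subseteq> A" "\<And>k. h k 0 = 0"
  shows "pm_sum h f = (\<Sum>k\<in>A. h k (Poly_Mapping.lookup f k))"
  unfolding pm_sum_def using assms
  by (intro sum.mono_neutral_left) (auto simp: in_keys_iff)

lemma pm_sum_zero [simp]: "pm_sum h 0 = 0"
  by (simp add: pm_sum_def)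

lemma pm_sum_single: "h k 0 = 0 \<Longrightarrow> pm_sum h (Poly_Mapping.single k c) = h k c"
  by (cases "c = 0") (simp_all add: pm_sum_def)

text \<open>Every linear extension below (\<open>leval\<close>, \<open>qp_extend\<close>,
  \<open>tensor\<close>, \<open>free_comult\<close>, \<open>free_act\<close>,
  \<open>pair_act\<close>) is such a sum and inherits additivity from here. Cancellation can shrink
  the support of \<open>f + g\<close>, so all three sums are taken over the union of the supports;
  \<open>h k 0 = 0\<close> follows from additivity itself.\<close>

lemma pm_sum_add:
  fixes h :: "'k \<Rightarrow> 'c::monoid_add \<Rightarrow> 'v::ab_group_add"
  assumes "\<And>k a b. h k (a + b) = h k a + h k b"
  shows "pm_sum h (f + g) = pm_sum h f + pm_sum h g"
proof -
  have 0: "h k 0 = 0" for k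
    using assms[of k 0 0] by simp
  let ?A = "Poly_Mapping.keys f \<union> Poly_Mapping.keys g"
  have "pm_sum h (f + g) = (\<Sum>k\<in>?A. h k (Poly_Mapping.lookup (f + g) k))"
    by (rule pm_sum_superset) (simp_all add: keys_add 0)
  also have "\<dots> = (\<Sum>k\<in>?A. h k (Poly_Mapping.lookup f k)) + (\<Sum>k\<in>?A. h k (Poly_Mapping.lookup g k))"
    by (simp add: lookup_add assms sum.distrib)
  also have "\<dots> = pm_sum h f + pm_sum h g"
    by (simp add: pm_sum_superset[of ?A f] pm_sum_superset[of ?A g] 0)
  finally show ?thesis .
qed

text \<open>There is no freshness condition on keys, so additive statements need no bookkeeping of
  supports; the zero function is covered by a single term with coefficient 0.\<close>

lemma poly_mapping_add_induct [case_names single add]: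
  fixes f :: "'k \<Rightarrow>\<^sub>0 'c::monoid_add"
  assumes single: "\<And>k c. P (Poly_Mapping.single k c)"
    and add: "\<And>f g. P f \<Longrightarrow> P g \<Longrightarrow> P (f + g)"
  shows "P f"
proof (induction f rule: Poly_Mapping.update_induct)
  case const
  show ?case using single[of undefined 0] by simp
next
  case (update f a b)
  have "Poly_Mapping.update a b f = f + Poly_Mapping.single a b"
    using update.hyps
    by (intro poly_mapping_eqI) (auto simp: lookup_update lookup_add lookup_single in_keys_iff)
  then show ?case using add[OF update.IH single] by simp
qed

section \<open>Quantum binomial coefficients\<close>

lemma lvar_0: "lvar 0 = 1"
  by (simp add: lvar_def)

lemma lvar_mult: "lvar a * lvar b = lvar (a + b)"
  by (simp add: lvar_def mult_single)

lemma lvar_inject: "lvar a = lvar b \<longleftrightarrow> a = b"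
  unfolding lvar_def by (metis lookup_single_eq lookup_single_not_eq zero_neq_one)

lemma leval_conv: "leval z f = pm_sum (\<lambda>k c. c * z powi k) f"
  by (simp add: leval_def pm_sum_def)

lemma leval_add: "leval z (f + g) = leval z f + leval z g"
  unfolding leval_conv by (rule pm_sum_add) (simp add: algebra_simps)

lemma leval_single: "leval z (Poly_Mapping.single k c) = c * z powi k"
  unfolding leval_conv by (rule pm_sum_single) simp

lemma leval_lvar: "leval z (lvar k) = z powi k"
  by (simp add: lvar_def leval_single)

lemma leval_1: "leval z 1 = 1"
  by (simp add: leval_lvar flip: lvar_0)

lemma leval_mult:
  assumes "z \<noteq> 0"
  shows "leval z (f * g) = leval z f * leval z g"
proof (induction f rule: poly_mapping_add_induct)
  case (single k c)
  show ?case
    by (induction g rule: poly_mapping_add_induct)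
      (simp_all add: mult_single leval_single leval_add distrib_left assms power_int_add)
qed (simp add: leval_add distrib_right)

lemma leval_diff: "leval z (f - g) = leval z f - leval z g"
  using leval_add[of z "f - g" g] by simp

text \<open>Laurent polynomials form an integral domain, so a quotient by \<open>b\<close> is
  unique; every use of \<open>lquot\<close> comes down to exhibiting one.\<close>

lemma lquot_eqI: "b \<noteq> 0 \<Longrightarrow> c * b = a \<Longrightarrow> lquot a b = c"
  unfolding lquot_def by (rule the_equality) auto

lemma lvar_diff_nonzero: "a \<noteq> b \<Longrightarrow> lvar a - lvar b \<noteq> 0"
  by (simp add: lvar_inject)

lemma lnum_mult: "lnum n * (lvar 1 - lvar (-1)) = lvar (int n) - lvar (- int n)"
proof -
  have "\<exists>c. c * (lvar 1 - lvar (-1)) = lvar (int n) - lvar (- int n)"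
  proof (induction n)
    case 0
    then show ?case by (auto intro!: exI[of _ 0])
  next
    case (Suc n)
    then obtain c where c: "c * (lvar 1 - lvar (-1)) = lvar (int n) - lvar (- int n)" by blast
    \<comment> \<open>The recurrence [n+1] = v [n] + v^(-n) supplies the witness.\<close>
    have "(lvar 1 * c + lvar (- int n)) * (lvar 1 - lvar (-1)) = lvar (int (Suc n)) - lvar (- int (Suc n))"
      by (simp add: distrib_right c mult.assoc)
         (simp add: algebra_simps lvar_mult)
    then show ?case by blast
  qed
  then obtain c where c: "c * (lvar 1 - lvar (-1)) = lvar (int n) - lvar (- int n)" by blast
  then have "lnum n = c"
    unfolding lnum_def by (intro lquot_eqI lvar_diff_nonzero) auto
  with c show ?thesis by simp
qed

lemma lnum_nonzero: "n > 0 \<Longrightarrow> lnum n \<noteq> 0"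
  using lnum_mult[of n] lvar_diff_nonzero[of "int n" "- int n"] by auto

lemma lnum_add: "lnum (m + n) = lvar (int n) * lnum m + lvar (- int m) * lnum n"
proof -
  have "lnum (m + n) * (lvar 1 - lvar (-1))
      = (lvar (int n) * lnum m + lvar (- int m) * lnum n) * (lvar 1 - lvar (-1))"
    by (simp only: lnum_mult distrib_right mult.assoc)
       (simp add: algebra_simps lvar_mult)
  then show ?thesis using lvar_diff_nonzero[of 1 "-1"] by simp
qed

lemma lnum_add': "lnum (m + n) = lvar (- int n) * lnum m + lvar (int m) * lnum n"
  using lnum_add[of n m] by (simp add: add.commute)

lemma lfact_0 [simp]: "lfact 0 = 1"
  by (simp add: lfact_def)

lemma lfact_Suc: "lfact (Suc n) = lnum (Suc n) * lfact n"
  by (simp add: lfact_def mult.commute)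

lemma lfact_nonzero: "lfact n \<noteq> 0"
  by (induction n) (auto simp: lfact_Suc lnum_nonzero)

text \<open>\<open>lbinom\<close> is a definite description, so [m]! [r]! must be shown to divide
  [m+r]! among Laurent polynomials. The quotient is built by the q-Pascal recurrence, by induction
  on m + r.\<close>

lemma lbinom_mult: "lbinom (m + r) m * (lfact m * lfact r) = lfact (m + r)"
proof -
  have "\<exists>c. c * (lfact m * lfact r) = lfact (m + r)"
  proof (induction "m + r" arbitrary: m r)
    case 0
    then show ?case by (auto intro!: exI[of _ 1])
  next
    case (Suc k)
    show ?case
    proof (cases "m = 0 \<or> r = 0")
      case True
      then show ?thesis by (auto intro!: exI[of _ 1])
    next
      case False
      then obtain m' r' where m: "m = Suc m'" and r: "r = Suc r'"
        by (metis not0_implies_Suc)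
      from Suc(1)[of m' r] Suc(1)[of m r'] Suc(2) m r
      obtain c d where c: "c * (lfact m' * lfact r) = lfact k"
        and d: "d * (lfact m * lfact r') = lfact k"
        by (metis add_Suc add_Suc_right diff_Suc_1)
      \<comment> \<open>Splitting [m+r] into multiples of [m] and [r] lets each summand absorb the
        factor missing from one of the two smaller denominators.\<close>
      have "lfact (m + r) = (lvar (int r) * lnum m + lvar (- int m) * lnum r) * lfact k"
        using Suc(2) by (metis lfact_Suc lnum_add)
      also have "\<dots> = lvar (int r) * lnum m * (c * (lfact m' * lfact r))
          + lvar (- int m) * lnum r * (d * (lfact m * lfact r'))"
        by (simp add: c d distrib_right)
      also have "\<dots> = (lvar (int r) * c + lvar (- int m) * d) * (lfact m * lfact r)"
        by (simp add: m r lfact_Suc algebra_simps)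
      finally show ?thesis by metis
    qed
  qed
  then obtain c where c: "c * (lfact m * lfact r) = lfact (m + r)" by blast
  then have "lbinom (m + r) m = c"
    unfolding lbinom_def by (intro lquot_eqI) (auto simp: lfact_nonzero mult.commute)
  with c show ?thesis by simp
qed

text \<open>Factorials never vanish for a generic parameter, whereas at q they do from [p]! on;
  hence the identities below are proved before evaluation.\<close>

lemma lbinom_eqI: "x * (lfact m * lfact r) = lfact (m + r) \<Longrightarrow> lbinom (m + r) m = x"
  using lbinom_mult[of m r] lfact_nonzero by (metis mult_cancel_right mult_eq_0_iff)

text \<open>Multiplied by [m+1]! [r+1]!, both rules become the splittings \<open>lnum_add\<close>
  and \<open>lnum_add'\<close> of [m+r+2], times [m+r+1]!. Inverting v exchanges the two forms; the
  coproduct of E needs one and that of F the other.\<close>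

lemma lbinom_pascal:
  "lbinom (Suc m + Suc r) (Suc m)
    = lvar (int (Suc r)) * lbinom (m + Suc r) m + lvar (- int (Suc m)) * lbinom (Suc m + r) (Suc m)"
  "lbinom (Suc m + Suc r) (Suc m)
    = lvar (- int (Suc r)) * lbinom (m + Suc r) m + lvar (int (Suc m)) * lbinom (Suc m + r) (Suc m)"
proof -
  have 1: "lbinom (m + Suc r) m * (lfact (Suc m) * lfact (Suc r)) = lnum (Suc m) * lfact (Suc (m + r))"
    using lbinom_mult[of m "Suc r"] by (simp add: lfact_Suc[of m] algebra_simps)
  have 2: "lbinom (Suc m + r) (Suc m) * (lfact (Suc m) * lfact (Suc r)) = lnum (Suc r) * lfact (Suc (m + r))"
    using lbinom_mult[of "Suc m" r] by (simp add: lfact_Suc[of r] algebra_simps)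
  have 3: "lfact (Suc m + Suc r) = lnum (Suc m + Suc r) * lfact (Suc (m + r))"
    using lfact_Suc[of "Suc (m + r)"] by simp
  show "lbinom (Suc m + Suc r) (Suc m)
    = lvar (int (Suc r)) * lbinom (m + Suc r) m + lvar (- int (Suc m)) * lbinom (Suc m + r) (Suc m)"
    by (rule lbinom_eqI, simp only: distrib_right mult.assoc 1 2 3 lnum_add[of "Suc m" "Suc r"])
  show "lbinom (Suc m + Suc r) (Suc m)
    = lvar (- int (Suc r)) * lbinom (m + Suc r) m + lvar (int (Suc m)) * lbinom (Suc m + r) (Suc m)"
    by (rule lbinom_eqI, simp only: distrib_right mult.assoc 1 2 3 lnum_add'[of "Suc m" "Suc r"])
qed

lemma lbinom_step:
  "lnum (Suc m) * lbinom (Suc m + r) (Suc m) = lnum (Suc (m + r)) * lbinom (m + r) m"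
  "lnum (Suc r) * lbinom (m + Suc r) m = lnum (Suc (m + r)) * lbinom (m + r) m"
proof -
  have "lnum (Suc m) * lbinom (Suc m + r) (Suc m) * (lfact m * lfact r)
      = lnum (Suc (m + r)) * lbinom (m + r) m * (lfact m * lfact r)"
    using lbinom_mult[of "Suc m" r] lbinom_mult[of m r]
    by (simp add: lfact_Suc algebra_simps) 
  then show "lnum (Suc m) * lbinom (Suc m + r) (Suc m) = lnum (Suc (m + r)) * lbinom (m + r) m"
    by (simp add: lfact_nonzero)
  have "lnum (Suc r) * lbinom (m + Suc r) m * (lfact m * lfact r)
      = lnum (Suc (m + r)) * lbinom (m + r) m * (lfact m * lfact r)"
    using lbinom_mult[of m "Suc r"] lbinom_mult[of m r]
    by (simp add: lfact_Suc algebra_simps)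
  then show "lnum (Suc r) * lbinom (m + Suc r) m = lnum (Suc (m + r)) * lbinom (m + r) m"
    by (simp add: lfact_nonzero)
qed

text \<open>Both sides equal [m+r+s]! / ([m]! [r]! [s]!). This is the source of associativity on
  monomials.\<close>

lemma lbinom_trinomial:
  "lbinom (m + r) m * lbinom (m + r + s) (m + r) = lbinom (r + s) r * lbinom (m + (r + s)) m"
proof -
  have "lbinom (m + r) m * lbinom (m + r + s) (m + r) * (lfact m * lfact r * lfact s)
      = lbinom (m + r + s) (m + r) * ((lbinom (m + r) m * (lfact m * lfact r)) * lfact s)"
    by (simp add: algebra_simps)
  also have "\<dots> = lbinom (m + (r + s)) m * (lfact m * (lbinom (r + s) r * (lfact r * lfact s)))"
    using lbinom_mult[of "m + r" s] by (simp add: lbinom_mult add.assoc)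
  also have "\<dots> = lbinom (r + s) r * lbinom (m + (r + s)) m * (lfact m * lfact r * lfact s)"
    by (simp add: algebra_simps)
  finally show ?thesis by (simp add: lfact_nonzero)
qed

lemma lbinom_0: "lbinom (0 + r) 0 = 1" "lbinom (m + 0) m = 1"
  by (rule lbinom_eqI, simp)+

section \<open>Evaluation at the root of unity\<close>

locale root_param =
  fixes p :: nat
  assumes p_ge_2: "p \<ge> 2"
begin

text \<open>Powers of q carry integer exponents so that products can be merged with
  \<open>Q_add\<close> and compared by integer arithmetic on the exponents.\<close>

definition Q :: "int \<Rightarrow> complex"
  where "Q k = qpar p powi k"

definition N :: "int \<Rightarrow> complex"
  where "N k = (Q k - Q (- k)) / (Q 1 - Q (-1))"

text \<open>\<open>B m r\<close> is $\left[{m+r\atop m}\right]$, extended by zero to negative arguments so that the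
  identities below need no case distinctions at the boundary.\<close>

definition B :: "int \<Rightarrow> int \<Rightarrow> complex"
  where "B m r = (if m < 0 \<or> r < 0 then 0 else qbinom p (nat m + nat r) (nat m))"

lemma qpar_nonzero [simp]: "qpar p \<noteq> 0"
  by (simp add: qpar_def)

lemma Q_add: "Q (a + b) = Q a * Q b"
  by (simp add: Q_def power_int_add)

lemma Q_diff: "Q (a - b) = Q a / Q b"
  by (simp add: Q_def power_int_diff)

lemma Q_minus: "Q (- a) = inverse (Q a)"
  by (simp add: Q_def power_int_minus)

lemma Q_nonzero [simp]: "Q a \<noteq> 0"
  by (simp add: Q_def)

lemma Q_0 [simp]: "Q 0 = 1"
  by (simp add: Q_def)

lemma Q_cis: "Q (2 * int k) = cis (2 * pi * (real k / real p))"
proof -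
  have "Q (2 * int k) = qpar p ^ (2 * k)"
    using power_int_of_nat[of "qpar p" "2 * k"] by (simp add: Q_def)
  also have "qpar p = cis (pi / real p)"
    by (simp add: qpar_def cis_conv_exp)
  also have "cis (pi / real p) ^ (2 * k) = cis (2 * pi * (real k / real p))"
    unfolding DeMoivre by (simp add: field_simps)
  finally show ?thesis .
qed

lemma Q_2p: "Q (2 * int p) = 1"
  using p_ge_2 by (simp add: Q_cis)

text \<open>q^2 has exact order p: otherwise the angle 2 pi k / p would be a multiple of 2 pi, and k
  / p an integer strictly between 0 and 1.\<close>

lemma Q_2_neq_1:
  assumes "0 < k" "k < p"
  shows "Q (2 * int k) \<noteq> 1"
proof
  assume "Q (2 * int k) = 1"
  then have "Re (cis (2 * pi * (real k / real p))) = 1"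
    by (simp add: Q_cis)
  then obtain n :: int where "2 * pi * (real k / real p) = of_int n * 2 * pi"
    by (auto simp: cos_one_2pi_int)
  then have "2 * pi * (real k / real p) = 2 * pi * of_int n"
    by (simp only: mult_ac)
  then have n: "real k / real p = of_int n"
    by (simp only: mult_cancel_left) simp
  have "0 < real k / real p" "real k / real p < 1"
    using assms by simp_all
  then show False unfolding n by simp
qed

lemma Q1_diff_nonzero: "Q 1 - Q (-1) \<noteq> 0"
proof
  assume "Q 1 - Q (-1) = 0"
  then have "Q (1 + 1) = 1"
    unfolding Q_add by (simp add: Q_minus field_simps)
  then show False using Q_2_neq_1[of 1] p_ge_2 by simp
qed

lemma N_0 [simp]: "N 0 = 0"
  by (simp add: N_def)

lemma N_mult: "N k * (Q 1 - Q (-1)) = Q k - Q (- k)"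
  using Q1_diff_nonzero by (simp add: N_def)

lemma N_eqI: "x * (Q 1 - Q (-1)) = y * (Q 1 - Q (-1)) \<Longrightarrow> x = y"
  using Q1_diff_nonzero by simp

lemma N_nonzero:
  assumes "0 < k" "k < p"
  shows "N (int k) \<noteq> 0"
proof
  assume "N (int k) = 0"
  then have "Q (int k) = Q (- int k)"
    using N_mult[of "int k"] by simp
  then have "Q (int k + int k) = 1"
    unfolding Q_add by (simp add: Q_minus field_simps)
  then show False using Q_2_neq_1[OF assms] by simp
qed

lemma N_eq_0: "int p dvd k \<Longrightarrow> N k = 0"
proof -
  assume "int p dvd k"
  then obtain j where k: "k = int p * j" by blast
  have "Q (k + k) = (Q (2 * int p)) powi j"
    by (simp add: Q_def k algebra_simps flip: power_int_mult)
  then have "Q k * Q k = 1" by (simp add: Q_2p flip: Q_add)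
  then show "N k = 0" by (simp add: N_def Q_minus field_simps)
qed

lemma qnum_conv: "qnum p n = N (int n)"
  by (simp add: qnum_def N_def Q_def power_int_minus power_inverse)

lemma N_conv_lnum: "N (int n) = leval (qpar p) (lnum n)"
proof (rule N_eqI)
  have "leval (qpar p) (lnum n) * (Q 1 - Q (-1)) = leval (qpar p) (lnum n * (lvar 1 - lvar (-1)))"
    by (simp add: leval_mult leval_diff leval_lvar Q_def)
  also have "\<dots> = Q (int n) - Q (- int n)"
    by (simp add: lnum_mult leval_diff leval_lvar Q_def)
  finally show "N (int n) * (Q 1 - Q (-1)) = leval (qpar p) (lnum n) * (Q 1 - Q (-1))"
    by (simp add: N_mult)
qed

lemma B_of_nat: "B (int m) (int r) = leval (qpar p) (lbinom (m + r) m)"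
  by (simp add: B_def qbinom_def)

lemma B_neg [simp]: "m < 0 \<Longrightarrow> B m r = 0" "r < 0 \<Longrightarrow> B m r = 0"
  by (simp_all add: B_def)

lemma B_0_left: "r \<ge> 0 \<Longrightarrow> B 0 r = 1"
  using B_of_nat[of 0 "nat r"] lbinom_0(1)[of "nat r"] by (simp add: leval_1)

lemma B_0_right: "m \<ge> 0 \<Longrightarrow> B m 0 = 1"
  using B_of_nat[of "nat m" 0] lbinom_0(2)[of "nat m"] by (simp add: leval_1)

text \<open>The pair (0, 0) has to be excluded: there the left side is 1 while both neighbours on
  the right vanish by the zero extension.\<close>

lemma B_pascal:
  assumes "m \<noteq> 0 \<or> r \<noteq> 0"
  shows "B m r = Q r * B (m - 1) r + Q (- m) * B m (r - 1)"
    and "B m r = Q (- r) * B (m - 1) r + Q m * B m (r - 1)"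
proof -
  consider "m < 0 \<or> r < 0" | "m = 0" "r > 0" | "m > 0" "r = 0" | "m > 0" "r > 0"
    using assms by linarith
  then have "B m r = Q r * B (m - 1) r + Q (- m) * B m (r - 1) \<and>
             B m r = Q (- r) * B (m - 1) r + Q m * B m (r - 1)"
  proof cases
    case 4
    define m' r' where "m' = nat (m - 1)" and "r' = nat (r - 1)"
    with 4 have mr: "m = int (Suc m')" "r = int (Suc r')" by auto
    have B: "B m r = leval (qpar p) (lbinom (Suc m' + Suc r') (Suc m'))"
         "B (m - 1) r = leval (qpar p) (lbinom (m' + Suc r') m')"
         "B m (r - 1) = leval (qpar p) (lbinom (Suc m' + r') (Suc m'))"
      using B_of_nat[of "Suc m'" "Suc r'"] B_of_nat[of "m'" "Suc r'"] B_of_nat[of "Suc m'" r']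
      by (simp_all add: mr)
    show ?thesis
      using arg_cong[OF lbinom_pascal(1)[of m' r'], of "leval (qpar p)"]
        arg_cong[OF lbinom_pascal(2)[of m' r'], of "leval (qpar p)"]
      by (simp add: B leval_add leval_mult leval_lvar Q_def del: of_nat_Suc flip: mr)
  qed (auto simp: B_0_left B_0_right)
  then show "B m r = Q r * B (m - 1) r + Q (- m) * B m (r - 1)"
    and "B m r = Q (- r) * B (m - 1) r + Q m * B m (r - 1)" by auto
qed

text \<open>No sign conditions are required: at \<open>m = 0\<close> in the first rule and
  \<open>r = 0\<close> in the second, the factor \<open>N 0\<close> kills the left side and the zero
  extension of \<open>B\<close> the right side.\<close>

lemma B_step:
  "N m * B m r = N (m + r) * B (m - 1) r"
  "N r * B m r = N (m + r) * B m (r - 1)"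
proof -
  show "N m * B m r = N (m + r) * B (m - 1) r"
  proof (cases "m > 0 \<and> r \<ge> 0")
    case True
    define m' r' where "m' = nat (m - 1)" and "r' = nat r"
    with True have mr: "m = int (Suc m')" "r = int r'" by auto
    show ?thesis
      using arg_cong[OF lbinom_step(1)[of m' r'], of "leval (qpar p)"]
        B_of_nat[of "Suc m'" r'] B_of_nat[of m' r'] N_conv_lnum[of "Suc m'"] N_conv_lnum[of "Suc (m' + r')"]
      by (simp add: mr leval_mult algebra_simps)
  next
    case False
    then show ?thesis by (cases "m = 0") auto
  qed
  show "N r * B m r = N (m + r) * B m (r - 1)"
  proof (cases "m \<ge> 0 \<and> r > 0")
    case True
    define m' r' where "m' = nat m" and "r' = nat (r - 1)"
    with True have mr: "m = int m'" "r = int (Suc r')" by auto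
    show ?thesis
      using arg_cong[OF lbinom_step(2)[of r' m'], of "leval (qpar p)"]
        B_of_nat[of m' "Suc r'"] B_of_nat[of m' r'] N_conv_lnum[of "Suc r'"] N_conv_lnum[of "Suc (m' + r')"]
      by (simp add: mr leval_mult algebra_simps)
  next
    case False
    then show ?thesis by (cases "r = 0") auto
  qed
qed

lemma B_trinomial: "B m r * B (m + r) s = B r s * B m (r + s)"
proof (cases "m \<ge> 0 \<and> r \<ge> 0 \<and> s \<ge> 0")
  case True
  define m' r' s' where "m' = nat m" and "r' = nat r" and "s' = nat s"
  with True have mrs: "m = int m'" "r = int r'" "s = int s'" by auto
  show ?thesis
    using arg_cong[OF lbinom_trinomial[of m' r' s'], of "leval (qpar p)"]
      B_of_nat[of m' r'] B_of_nat[of "m' + r'" s'] B_of_nat[of r' s'] B_of_nat[of m' "r' + s'"]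
    by (simp add: mrs leval_mult)
next
  case False
  then show ?thesis
    by (metis B_neg linorder_not_le mult_zero_left mult_zero_right)
qed

end

section \<open>Linear operators on the quantum plane\<close>

lemma lookup_qp_scale: "Poly_Mapping.lookup (qp_scale c u) k = c * Poly_Mapping.lookup u k"
  by (simp add: qp_scale_def map.rep_eq when_def)

interpretation qp: vector_space qp_scale
  by standard
    (auto simp: lookup_qp_scale lookup_add algebra_simps intro!: poly_mapping_eqI)

interpretation qpp: module_pair qp_scale qp_scale ..

abbreviation qlinear :: "qop \<Rightarrow> bool"
  where "qlinear \<equiv> module_hom qp_scale qp_scale"

lemma qlinear_compose: "qlinear T \<Longrightarrow> qlinear S \<Longrightarrow> qlinear (S \<circ> T)"
  by (rule module_hom_compose)

lemma qlinear_ident: "qlinear (\<lambda>u. u)"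
  by unfold_locales simp_all

lemma mon_eq_0 [simp]: "m < 0 \<or> n < 0 \<Longrightarrow> mon m n = 0"
  by (auto simp: mon_def)

lemma single_conv_mon: "Poly_Mapping.single (m, n) c = qp_scale c (mon (int m) (int n))"
  by (rule poly_mapping_eqI) (simp add: mon_def lookup_qp_scale lookup_single when_def)

lemma qp_extend_conv: "qp_extend \<phi> u = pm_sum (\<lambda>(m, n) c. qp_scale c (\<phi> m n)) u"
  by (simp add: qp_extend_def pm_sum_def case_prod_beta)

lemma qp_extend_add: "qp_extend \<phi> (u + v) = qp_extend \<phi> u + qp_extend \<phi> v"
  unfolding qp_extend_conv by (rule pm_sum_add) (auto simp: qp.scale_left_distrib)

lemma qp_extend_mon: "qp_extend \<phi> (mon (int m) (int n)) = \<phi> m n"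
  by (simp add: qp_extend_conv mon_def pm_sum_single)

lemma qp_extend_single: "qp_extend \<phi> (Poly_Mapping.single (m, n) c) = qp_scale c (\<phi> m n)"
  by (simp add: qp_extend_conv pm_sum_single)

lemma qp_scale_single: "qp_scale c (Poly_Mapping.single k d) = Poly_Mapping.single k (c * d)"
  by (rule poly_mapping_eqI) (simp add: lookup_qp_scale lookup_single when_def)

lemma qlinear_qp_extend: "qlinear (qp_extend \<phi>)"
proof
  show "qp_extend \<phi> (qp_scale c u) = qp_scale c (qp_extend \<phi> u)" for c u
    by (induction u rule: poly_mapping_add_induct)
      (auto simp: qp_extend_add qp.scale_right_distrib qp_scale_single qp_extend_single)
qed (rule qp_extend_add)

lemma qlinear_eq_on_mon:
  assumes "qlinear S" "qlinear T" "\<And>m n. m \<ge> 0 \<Longrightarrow> n \<ge> 0 \<Longrightarrow> S (mon m n) = T (mon m n)"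
  shows "S u = T u"
proof (induction u rule: poly_mapping_add_induct)
  case (single k c)
  show ?case
    by (cases k) (simp add: single_conv_mon assms module_hom.scale[OF assms(1)] module_hom.scale[OF assms(2)])
qed (simp add: module_hom.add[OF assms(1)] module_hom.add[OF assms(2)])

lemma qlinear_qp_mult: "qlinear (qp_mult p a)"
  unfolding qp_mult_def
proof (induction a rule: poly_mapping_add_induct)
  case (single k c)
  show ?case
    by (cases k)
      (auto simp: qp_extend_single intro!: qpp.module_hom_scale qlinear_qp_extend)
next
  case (add f g)
  then show ?case
    by (simp add: qp_extend_add qpp.module_hom_add)
qed

lemma qlinear_qp_mult_left: "qlinear (\<lambda>a. qp_mult p a u)"
  unfolding qp_mult_def by (rule qlinear_qp_extend)

lemma qp_mult_add_left: "qp_mult p (a + b) = qp_mult p a + qp_mult p b"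
  by (rule ext) (simp add: module_hom.add[OF qlinear_qp_mult_left])

lemma qp_mult_scale_left: "qp_mult p (qp_scale c a) = op_scale c (qp_mult p a)"
  by (rule ext) (simp add: op_scale_def module_hom.scale[OF qlinear_qp_mult_left])

lemma qp_mult_zero_left: "qp_mult p 0 = 0"
  by (rule ext) (simp add: module_hom.zero[OF qlinear_qp_mult_left])

text \<open>The antipode and the coproduct of F involve K^(-1), whose action on the plane is not
  among the given maps.\<close>

definition qp_Kinv :: "nat \<Rightarrow> qplane \<Rightarrow> qplane"
  where "qp_Kinv p = qp_extend (\<lambda>m n. qp_scale (qpar p powi (int n - int m)) (mon (int m) (int n)))"

lemma qlinear_ops:
  "qlinear (qp_E p)" "qlinear (qp_F p)" "qlinear (qp_K p)" "qlinear (qp_Kinv p)"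
  "qlinear (dx p)" "qlinear (dy p)"
  by (simp_all add: qp_E_def qp_F_def qp_K_def qp_Kinv_def dx_def dy_def qlinear_qp_extend)

section \<open>Generators, derivatives and product on monomials\<close>

context root_param
begin

abbreviation "E \<equiv> qp_E p"
abbreviation "F \<equiv> qp_F p"
abbreviation "K \<equiv> qp_K p"
abbreviation "Ki \<equiv> qp_Kinv p"

text \<open>A zero monomial could acquire a nonzero image only at \<open>m = -1\<close>, and there
  the coefficient [0] vanishes. The same happens for \<open>F\<close> at
  \<open>n = -1\<close>.\<close>

lemma E_mon: "E (mon m n) = qp_scale (N (m + 1)) (mon (m + 1) (n - 1))"
proof (cases "m \<ge> 0 \<and> n \<ge> 0")
  case True
  then show ?thesis
    using qp_extend_mon[of _ "nat m" "nat n"] by (simp add: qp_E_def qnum_conv add.commute)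
next
  case False
  then show ?thesis by (cases "m = -1") (auto simp: module_hom.zero[OF qlinear_ops(1)])
qed

lemma F_mon: "F (mon m n) = qp_scale (N (n + 1)) (mon (m - 1) (n + 1))"
proof (cases "m \<ge> 0 \<and> n \<ge> 0")
  case True
  then show ?thesis
    using qp_extend_mon[of _ "nat m" "nat n"] by (simp add: qp_F_def qnum_conv add.commute)
next
  case False
  then show ?thesis by (cases "n = -1") (auto simp: module_hom.zero[OF qlinear_ops(2)])
qed

lemma K_mon: "K (mon m n) = qp_scale (Q (m - n)) (mon m n)"
  using qp_extend_mon[of _ "nat m" "nat n"] module_hom.zero[OF qlinear_ops(3)]
  by (cases "m \<ge> 0 \<and> n \<ge> 0") (auto simp: qp_K_def Q_def)

lemma Ki_mon: "Ki (mon m n) = qp_scale (Q (n - m)) (mon m n)"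
  using qp_extend_mon[of _ "nat m" "nat n"] module_hom.zero[OF qlinear_ops(4)]
  by (cases "m \<ge> 0 \<and> n \<ge> 0") (auto simp: qp_Kinv_def Q_def)

lemma dx_mon: "dx p (mon m n) = qp_scale (Q (- m - 2 * n + 1)) (mon (m - 1) n)"
  using qp_extend_mon[of _ "nat m" "nat n"] module_hom.zero[OF qlinear_ops(5)]
  by (cases "m \<ge> 0 \<and> n \<ge> 0") (auto simp: dx_def Q_def)

lemma dy_mon: "dy p (mon m n) = qp_scale (Q (- m - n + 1)) (mon m (n - 1))"
  using qp_extend_mon[of _ "nat m" "nat n"] module_hom.zero[OF qlinear_ops(6)]
  by (cases "m \<ge> 0 \<and> n \<ge> 0") (auto simp: dy_def Q_def)

text \<open>If some exponent is negative, the product on the left is zero although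
  \<open>m + r\<close> and \<open>n + s\<close> may be nonnegative; on the right
  \<open>B m r\<close> or \<open>B n s\<close> is then zero too.\<close>

lemma mult_mon:
  "qp_mult p (mon m n) (mon r s) = qp_scale (Q (n * r) * B m r * B n s) (mon (m + r) (n + s))"
proof (cases "m \<ge> 0 \<and> n \<ge> 0 \<and> r \<ge> 0 \<and> s \<ge> 0")
  case True
  define m' n' r' s' where "m' = nat m" "n' = nat n" "r' = nat r" "s' = nat s"
  with True have [simp]: "m = int m'" "n = int n'" "r = int r'" "s = int s'" by auto
  have "Q (int n' * int r') = qpar p ^ (n' * r')"
    unfolding Q_def of_nat_mult[symmetric] by (rule power_int_of_nat)
  then show ?thesis
    by (simp add: qp_mult_def qp_extend_mon B_def)
next
  case False
  then show ?thesis
    using module_hom.zero[OF qlinear_qp_mult] by (auto simp: qp_mult_zero_left not_le)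
qed

lemmas mon_simps = E_mon F_mon K_mon Ki_mon dx_mon dy_mon mult_mon
lemmas qlin_scale = qlinear_ops[THEN module_hom.scale] qlinear_qp_mult[THEN module_hom.scale]
  qlinear_qp_mult_left[THEN module_hom.scale]

lemmas qlinear_intros = qlinear_ops[THEN qlinear_compose[unfolded comp_def, rotated]]
  qlinear_qp_mult[THEN qlinear_compose[unfolded comp_def, rotated]]
  qlinear_qp_mult_left[THEN qlinear_compose[unfolded comp_def, rotated]]
  qpp.module_hom_add qpp.module_hom_sub qpp.module_hom_scale qlinear_ident

lemma K_Ki [simp]: "K (Ki u) = u"
proof (rule qlinear_eq_on_mon[of "\<lambda>u. K (Ki u)" "\<lambda>u. u"])
  show "K (Ki (mon m n)) = mon m n" for m n
    by (simp add: mon_simps qlin_scale flip: Q_add)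
qed (intro qlinear_intros)+

lemma Ki_K [simp]: "Ki (K u) = u"
proof (rule qlinear_eq_on_mon[of "\<lambda>u. Ki (K u)" "\<lambda>u. u"])
  show "Ki (K (mon m n)) = mon m n" for m n
    by (simp add: mon_simps qlin_scale flip: Q_add)
qed (intro qlinear_intros)+

lemma bilinear_eq_on_mon:
  assumes "\<And>v. qlinear (\<lambda>u. f u v)" "\<And>v. qlinear (\<lambda>u. g u v)"
    and "\<And>u. qlinear (f u)" "\<And>u. qlinear (g u)"
    and "\<And>m n r s. f (mon m n) (mon r s) = g (mon m n) (mon r s)"
  shows "f u v = g u v"
proof -
  have "f (mon m n) v = g (mon m n) v" for m n v
    by (rule qlinear_eq_on_mon[of "f (mon m n)" "g (mon m n)"]) (rule assms)+
  then show ?thesis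
    by (rule qlinear_eq_on_mon[of "\<lambda>u. f u v" "\<lambda>u. g u v", OF assms(1,2)])
qed

section \<open>Coproduct rules on the quantum plane\<close>

lemma K_mult: "K (qp_mult p u v) = qp_mult p (K u) (K v)"
proof (rule bilinear_eq_on_mon[where f = "\<lambda>u v. K (qp_mult p u v)" and g = "\<lambda>u v. qp_mult p (K u) (K v)"])
  fix m n r s
  have "Q (m + r - (n + s)) = Q (m - n) * Q (r - s)"
    by (simp only: Q_add[symmetric], rule arg_cong[of _ _ Q], simp)
  then show "K (qp_mult p (mon m n) (mon r s)) = qp_mult p (K (mon m n)) (K (mon r s))"
    by (simp only: mon_simps qlin_scale qp.scale_scale mult_ac)
qed (intro qlinear_intros)+

lemma Ki_mult: "Ki (qp_mult p u v) = qp_mult p (Ki u) (Ki v)"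
  using Ki_K[of "qp_mult p (Ki u) (Ki v)"] by (simp only: K_mult K_Ki)

text \<open>The alternative \<open>u = 0\<close> covers the one failure of the q-Pascal rule: when
  both of its arguments are 0, the target monomial has a negative exponent.\<close>

lemma qp_scale_split:
  "u = 0 \<or> b = b1 + b2 \<Longrightarrow> qp_scale (c * b) u = qp_scale (c * b1) u + qp_scale (c * b2) u"
  by (auto simp: distrib_left qp.scale_left_distrib)

text \<open>The q-Pascal rule for the y-exponents splits the coefficient: the term lowering n
  belongs to E on the left factor, the term lowering s to E on the right factor. The weight q^(r-s)
  from K on the right factor selects the second form of the rule.\<close>

lemma E_mult: "E (qp_mult p u v) = qp_mult p (E u) (K v) + qp_mult p u (E v)"
proof (rule bilinear_eq_on_mon[where f = "\<lambda>u v. E (qp_mult p u v)" and g = "\<lambda>u v. qp_mult p (E u) (K v) + qp_mult p u (E v)"])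
  fix m n r s
  let ?x = "mon (m + r + 1) (n + s - 1)"
  \<comment> \<open>This is what both summands share once \<open>B_step\<close> has converted [m+1]
    and [r+1] into [m+r+1].\<close>
  define c where "c = Q (n * r) * (N (m + r + 1) * B m r)"
  have "E (qp_mult p (mon m n) (mon r s)) = qp_scale (c * B n s) ?x"
    by (simp add: mon_simps qlin_scale c_def mult_ac)
  also have "\<dots> = qp_scale (c * (Q (- s) * B (n - 1) s)) ?x + qp_scale (c * (Q n * B n (s - 1))) ?x"
    by (rule qp_scale_split) (use B_pascal(2)[of n s] in \<open>cases "n = 0 \<and> s = 0"; auto\<close>)
  also have "qp_scale (c * (Q (- s) * B (n - 1) s)) ?x = qp_mult p (E (mon m n)) (K (mon r s))"
  proof -
    have 1: "N (m + 1) * B (m + 1) r = N (m + r + 1) * B m r"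
      using B_step(1)[of "m + 1" r] by (simp add: add_ac)
    have 2: "Q ((n - 1) * r) * Q (r - s) = Q (n * r) * Q (- s)"
      by (simp only: Q_add[symmetric], rule arg_cong[of _ _ Q], simp add: algebra_simps)
    have 3: "m + 1 + r = m + r + 1" "n - 1 + s = n + s - 1" by simp_all
    have "qp_mult p (E (mon m n)) (K (mon r s))
        = qp_scale (Q ((n - 1) * r) * Q (r - s) * (N (m + 1) * B (m + 1) r) * B (n - 1) s) ?x"
      by (simp only: mon_simps qlin_scale qp.scale_scale 3 mult_ac)
    then show ?thesis unfolding 1 2 c_def by (simp only: mult_ac)
  qed
  also have "qp_scale (c * (Q n * B n (s - 1))) ?x = qp_mult p (mon m n) (E (mon r s))"
  proof -
    have 1: "N (r + 1) * B m (r + 1) = N (m + r + 1) * B m r"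
      using B_step(2)[of "r + 1" m] by (simp add: add_ac)
    have 2: "Q (n * (r + 1)) = Q (n * r) * Q n"
      by (simp only: Q_add[symmetric], rule arg_cong[of _ _ Q], simp add: algebra_simps)
    have 3: "m + (r + 1) = m + r + 1" "n + (s - 1) = n + s - 1" by simp_all
    have "qp_mult p (mon m n) (E (mon r s))
        = qp_scale (Q (n * (r + 1)) * (N (r + 1) * B m (r + 1)) * B n (s - 1)) ?x"
      by (simp only: mon_simps qlin_scale qp.scale_scale 3 mult_ac)
    then show ?thesis unfolding 1 2 c_def by (simp only: mult_ac)
  qed
  finally show "E (qp_mult p (mon m n) (mon r s))
      = qp_mult p (E (mon m n)) (K (mon r s)) + qp_mult p (mon m n) (E (mon r s))" .
qed (intro qlinear_intros)+

text \<open>As for E with x and y exchanged, but K^(-1) now stands on the left factor, which calls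
  for the first form of the q-Pascal rule.\<close>

lemma F_mult: "F (qp_mult p u v) = qp_mult p (F u) v + qp_mult p (Ki u) (F v)"
proof (rule bilinear_eq_on_mon[where f = "\<lambda>u v. F (qp_mult p u v)" and g = "\<lambda>u v. qp_mult p (F u) v + qp_mult p (Ki u) (F v)"])
  fix m n r s
  let ?x = "mon (m + r - 1) (n + s + 1)"
  define c where "c = Q (n * r) * (N (n + s + 1) * B n s)"
  have "F (qp_mult p (mon m n) (mon r s)) = qp_scale (c * B m r) ?x"
    by (simp add: mon_simps qlin_scale c_def mult_ac)
  also have "\<dots> = qp_scale (c * (Q r * B (m - 1) r)) ?x + qp_scale (c * (Q (- m) * B m (r - 1))) ?x"
    by (rule qp_scale_split) (use B_pascal(1)[of m r] in \<open>cases "m = 0 \<and> r = 0"; auto\<close>)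
  also have "qp_scale (c * (Q r * B (m - 1) r)) ?x = qp_mult p (F (mon m n)) (mon r s)"
  proof -
    have 1: "N (n + 1) * B (n + 1) s = N (n + s + 1) * B n s"
      using B_step(1)[of "n + 1" s] by (simp add: add_ac)
    have 2: "Q ((n + 1) * r) = Q (n * r) * Q r"
      by (simp only: Q_add[symmetric], rule arg_cong[of _ _ Q], simp add: algebra_simps)
    have 3: "m - 1 + r = m + r - 1" "n + 1 + s = n + s + 1" by simp_all
    have "qp_mult p (F (mon m n)) (mon r s)
        = qp_scale (Q ((n + 1) * r) * (N (n + 1) * B (n + 1) s) * B (m - 1) r) ?x"
      by (simp only: mon_simps qlin_scale qp.scale_scale 3 mult_ac)
    then show ?thesis unfolding 1 2 c_def by (simp only: mult_ac)
  qed
  also have "qp_scale (c * (Q (- m) * B m (r - 1))) ?x = qp_mult p (Ki (mon m n)) (F (mon r s))"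
  proof -
    have 1: "N (s + 1) * B n (s + 1) = N (n + s + 1) * B n s"
      using B_step(2)[of "s + 1" n] by (simp add: add_ac)
    have 2: "Q (n * (r - 1)) * Q (n - m) = Q (n * r) * Q (- m)"
      by (simp only: Q_add[symmetric], rule arg_cong[of _ _ Q], simp add: algebra_simps)
    have 3: "m + (r - 1) = m + r - 1" "n + (s + 1) = n + s + 1" by simp_all
    have "qp_mult p (Ki (mon m n)) (F (mon r s))
        = qp_scale (Q (n * (r - 1)) * Q (n - m) * (N (s + 1) * B n (s + 1)) * B m (r - 1)) ?x"
      by (simp only: mon_simps qlin_scale qp.scale_scale 3 mult_ac)
    then show ?thesis unfolding 1 2 c_def by (simp only: mult_ac)
  qed
  finally show "F (qp_mult p (mon m n) (mon r s))
      = qp_mult p (F (mon m n)) (mon r s) + qp_mult p (Ki (mon m n)) (F (mon r s))" .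
qed (intro qlinear_intros)+

section \<open>Commutation relations of multiplications and derivatives\<close>

lemma mult_mon_mult:
  "qp_mult p (mon m n) (qp_mult p (mon r s) u)
    = qp_scale (Q (n * r) * B m r * B n s) (qp_mult p (mon (m + r) (n + s)) u)"
proof (rule qlinear_eq_on_mon[of "\<lambda>u. qp_mult p (mon m n) (qp_mult p (mon r s) u)"])
  fix k l :: int
  have 1: "Q (n * r) * Q ((n + s) * k) = Q (s * k) * Q (n * (r + k))"
    by (simp only: Q_add[symmetric], rule arg_cong[of _ _ Q], simp add: algebra_simps)
  \<comment> \<open>Powers of q, x-binomials and y-binomials are grouped apart: the exponents agree,
    and \<open>B_trinomial\<close> handles each pair of binomials.\<close>
  have "Q (n * r) * B m r * B n s * (Q ((n + s) * k) * B (m + r) k * B (n + s) l)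
      = (Q (n * r) * Q ((n + s) * k)) * (B m r * B (m + r) k) * (B n s * B (n + s) l)"
    by (simp only: mult_ac)
  also have "\<dots> = (Q (s * k) * Q (n * (r + k))) * (B r k * B m (r + k)) * (B s l * B n (s + l))"
    by (simp only: 1 B_trinomial[of m r k] B_trinomial[of n s l])
  finally have 2: "Q (n * r) * B m r * B n s * (Q ((n + s) * k) * B (m + r) k * B (n + s) l)
      = Q (s * k) * B r k * B s l * (Q (n * (r + k)) * B m (r + k) * B n (s + l))"
    by (simp only: mult_ac)
  show "qp_mult p (mon m n) (qp_mult p (mon r s) (mon k l))
      = qp_scale (Q (n * r) * B m r * B n s) (qp_mult p (mon (m + r) (n + s)) (mon k l))"
    by (simp only: mon_simps qlin_scale qp.scale_scale add.assoc[of m r k] add.assoc[of n s l] 2)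
qed (intro qlinear_intros)+

lemma mon_00_mult: "qp_mult p (mon 0 0) u = u"
proof (rule qlinear_eq_on_mon[of "qp_mult p (mon 0 0)" "\<lambda>u. u"])
  show "qp_mult p (mon 0 0) (mon m n) = mon m n" if "m \<ge> 0" "n \<ge> 0" for m n
    using that by (simp add: mult_mon B_0_left)
qed (rule qlinear_qp_mult qlinear_ident)+

text \<open>The q-Pascal rule alone leaves the weight q^(-m-2n-2s+1) where the second term needs
  q^(-m-2n+1). Since q^(-2s) = 1 + q^(-s-1) (1 - q^2) [s], the discrepancy is a multiple of [s], and
  this is what the third term with \<open>dy\<close> produces.\<close>

lemma dx_mult:
  "dx p (qp_mult p (mon m n) u)
    = qp_scale (Q (- 2 * m - n)) (qp_mult p (mon m n) (dx p u))
      + qp_scale (Q (- m - 2 * n + 1)) (qp_mult p (mon (m - 1) n) u)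
      + qp_scale (Q (- m - 2 * n - 1) * (1 - Q 2) * N (n + 1)) (qp_mult p (mon (m - 1) (n + 1)) (dy p u))"
  (is "_ = ?R1 u + ?R2 u + ?R3 u")
proof (rule qlinear_eq_on_mon[of "\<lambda>u. dx p (qp_mult p (mon m n) u)"])
  fix r s :: int
  let ?x = "mon (m + r - 1) (n + s)"
  define a where "a = Q (n * r) * B n s * Q (- m - r - 2 * n - 2 * s + 1)"
  define b where "b = Q (n * r) * B n s * B (m - 1) r"
  have "dx p (qp_mult p (mon m n) (mon r s)) = qp_scale (a * B m r) ?x"
  proof -
    have 1: "- (m + r) - 2 * (n + s) + 1 = - m - r - 2 * n - 2 * s + 1" by simp
    show ?thesis by (simp only: mon_simps qlin_scale qp.scale_scale 1) (simp only: a_def mult_ac)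
  qed
  also have "\<dots> = qp_scale (a * (Q (- m) * B m (r - 1))) ?x + qp_scale (a * (Q r * B (m - 1) r)) ?x"
    by (rule qp_scale_split) (use B_pascal(1)[of m r] in \<open>cases "m = 0 \<and> r = 0"; auto\<close>)
  also have "qp_scale (a * (Q (- m) * B m (r - 1))) ?x = ?R1 (mon r s)"
  proof -
    have 1: "Q (- 2 * m - n) * Q (- r - 2 * s + 1) * Q (n * (r - 1))
        = Q (n * r) * Q (- m - r - 2 * n - 2 * s + 1) * Q (- m)"
      by (simp only: Q_add[symmetric], rule arg_cong[of _ _ Q], simp add: algebra_simps)
    have 2: "m + (r - 1) = m + r - 1" by simp
    have "?R1 (mon r s) = qp_scale (Q (- 2 * m - n) * Q (- r - 2 * s + 1) * Q (n * (r - 1)) * B m (r - 1) * B n s) ?x"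
      by (simp only: mon_simps qlin_scale qp.scale_scale 2 mult_ac)
    then show ?thesis unfolding 1 a_def by (simp only: mult_ac)
  qed
  also have "a * (Q r * B (m - 1) r)
      = b * (Q (- m - 2 * n + 1) + Q (- m - 2 * n) * Q (- s) * ((1 - Q 2) * N s))"
  proof -
    have "1 - Q 2 = - Q 1 * (Q 1 - Q (-1))"
      by (simp add: right_diff_distrib flip: Q_add)
    then have "(1 - Q 2) * N s = - Q 1 * (N s * (Q 1 - Q (-1)))"
      by (simp only: mult_ac)
    also have "\<dots> = Q 1 * Q (- s) - Q 1 * Q s"
      unfolding N_mult by (simp add: right_diff_distrib)
    finally have "Q (- m - 2 * n + 1) + Q (- m - 2 * n) * Q (- s) * ((1 - Q 2) * N s)
       = Q (- m - 2 * n + 1) + (Q (- m - 2 * n) * Q (- s) * Q 1 * Q (- s)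
          - Q (- m - 2 * n) * Q (- s) * Q 1 * Q s)"
      by (simp only: right_diff_distrib mult.assoc)
    also have "Q (- m - 2 * n) * Q (- s) * Q 1 * Q s = Q (- m - 2 * n + 1)"
      by (simp only: Q_add[symmetric], rule arg_cong[of _ _ Q], simp add: algebra_simps)
    also have "Q (- m - 2 * n) * Q (- s) * Q 1 * Q (- s) = Q (- m - 2 * n - 2 * s + 1)"
      by (simp only: Q_add[symmetric], rule arg_cong[of _ _ Q], simp add: algebra_simps)
    also have "Q (- m - 2 * n + 1) + (Q (- m - 2 * n - 2 * s + 1) - Q (- m - 2 * n + 1)) = Q (- m - 2 * n - 2 * s + 1)"
      by simp
    also have "\<dots> = Q (- m - r - 2 * n - 2 * s + 1) * Q r"
      by (simp only: Q_add[symmetric], rule arg_cong[of _ _ Q], simp add: algebra_simps)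
    finally show ?thesis
      unfolding a_def b_def by (simp only: mult_ac)
  qed
  also have "qp_scale \<dots> ?x = qp_scale (b * Q (- m - 2 * n + 1)) ?x
      + qp_scale (b * (Q (- m - 2 * n) * Q (- s) * ((1 - Q 2) * N s))) ?x"
    by (rule qp_scale_split) simp
  also have "qp_scale (b * Q (- m - 2 * n + 1)) ?x = ?R2 (mon r s)"
  proof -
    have 1: "m - 1 + r = m + r - 1" by simp
    show ?thesis by (simp only: mon_simps qlin_scale qp.scale_scale 1 b_def mult_ac)
  qed
  also have "qp_scale (b * (Q (- m - 2 * n) * Q (- s) * ((1 - Q 2) * N s))) ?x = ?R3 (mon r s)"
  proof -
    \<comment> \<open>Both sides equal [n+s] times the coefficient [n+s-1 choose n].\<close>
    have 1: "N (n + 1) * B (n + 1) (s - 1) = N s * B n s"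
      using B_step(1)[of "n + 1" "s - 1"] B_step(2)[of s n] by (simp add: add_ac)
    have 2: "Q (- m - 2 * n - 1) * Q (- r - s + 1) * Q ((n + 1) * r) = Q (n * r) * Q (- m - 2 * n) * Q (- s)"
      by (simp only: Q_add[symmetric], rule arg_cong[of _ _ Q], simp add: algebra_simps)
    have 3: "m - 1 + r = m + r - 1" "n + 1 + (s - 1) = n + s" by simp_all
    have "?R3 (mon r s) = qp_scale ((Q (- m - 2 * n - 1) * Q (- r - s + 1) * Q ((n + 1) * r))
        * (N (n + 1) * B (n + 1) (s - 1)) * B (m - 1) r * (1 - Q 2)) ?x"
      by (simp only: mon_simps qlin_scale qp.scale_scale 3 mult_ac)
    then show ?thesis unfolding 1 2 b_def by (simp only: mult_ac)
  qed
  finally show "dx p (qp_mult p (mon m n) (mon r s)) = ?R1 (mon r s) + ?R2 (mon r s) + ?R3 (mon r s)"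
    by (simp only: add.assoc)
qed (intro qlinear_intros)+

lemma dy_mult:
  "dy p (qp_mult p (mon m n) u)
    = qp_scale (Q (- m - 2 * n)) (qp_mult p (mon m n) (dy p u))
      + qp_scale (Q (- m - n + 1)) (qp_mult p (mon m (n - 1)) u)"
  (is "_ = ?R1 u + ?R2 u")
proof (rule qlinear_eq_on_mon[of "\<lambda>u. dy p (qp_mult p (mon m n) u)"])
  fix r s :: int
  let ?x = "mon (m + r) (n + s - 1)"
  define a where "a = Q (n * r) * B m r * Q (- m - r - n - s + 1)"
  have "dy p (qp_mult p (mon m n) (mon r s)) = qp_scale (a * B n s) ?x"
  proof -
    have 1: "- (m + r) - (n + s) + 1 = - m - r - n - s + 1" by simp
    show ?thesis by (simp only: mon_simps qlin_scale qp.scale_scale 1) (simp only: a_def mult_ac)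
  qed
  also have "\<dots> = qp_scale (a * (Q (- n) * B n (s - 1))) ?x + qp_scale (a * (Q s * B (n - 1) s)) ?x"
    by (rule qp_scale_split) (use B_pascal(1)[of n s] in \<open>cases "n = 0 \<and> s = 0"; auto\<close>)
  also have "qp_scale (a * (Q (- n) * B n (s - 1))) ?x = ?R1 (mon r s)"
  proof -
    have 1: "Q (- m - 2 * n) * Q (- r - s + 1) = Q (- m - r - n - s + 1) * Q (- n)"
      by (simp only: Q_add[symmetric], rule arg_cong[of _ _ Q], simp add: algebra_simps)
    have 2: "n + (s - 1) = n + s - 1" by simp
    have "?R1 (mon r s) = qp_scale (Q (- m - 2 * n) * Q (- r - s + 1) * Q (n * r) * B m r * B n (s - 1)) ?x"
      by (simp only: mon_simps qlin_scale qp.scale_scale 2 mult_ac)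
    then show ?thesis unfolding 1 a_def by (simp only: mult_ac)
  qed
  also have "qp_scale (a * (Q s * B (n - 1) s)) ?x = ?R2 (mon r s)"
  proof -
    have 1: "Q (- m - n + 1) * Q ((n - 1) * r) = Q (n * r) * Q (- m - r - n - s + 1) * Q s"
      by (simp only: Q_add[symmetric], rule arg_cong[of _ _ Q], simp add: algebra_simps)
    have 2: "n - 1 + s = n + s - 1" by simp
    have "?R2 (mon r s) = qp_scale (Q (- m - n + 1) * Q ((n - 1) * r) * B m r * B (n - 1) s) ?x"
      by (simp only: mon_simps qlin_scale qp.scale_scale 2 mult_ac)
    then show ?thesis unfolding 1 a_def by (simp only: mult_ac)
  qed
  finally show "dy p (qp_mult p (mon m n) (mon r s)) = ?R1 (mon r s) + ?R2 (mon r s)" .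
qed (intro qlinear_intros)+

lemma dy_dx: "dy p (dx p u) = qp_scale (Q (-1)) (dx p (dy p u))"
proof (rule qlinear_eq_on_mon[of "\<lambda>u. dy p (dx p u)"])
  fix m n :: int
  have "Q (- m - 2 * n + 1) * Q (- (m - 1) - n + 1) = Q (-1) * (Q (- m - n + 1) * Q (- m - 2 * (n - 1) + 1))"
    by (simp only: Q_add[symmetric], rule arg_cong[of _ _ Q], simp add: algebra_simps)
  then show "dy p (dx p (mon m n)) = qp_scale (Q (-1)) (dx p (dy p (mon m n)))"
    by (simp only: mon_simps qlin_scale qp.scale_scale)
qed (intro qlinear_intros)+

lemma N_Suc: "N (m + 1) = Q 1 * N m + Q (- m)" "N (m + 1) = Q (-1) * N m + Q m"
  by (rule N_eqI, simp add: distrib_right mult.assoc N_mult, simp add: Q_add Q_diff Q_minus field_simps)+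

subsection \<open>The action of $U$ on the quantum plane\<close>

lemma K_E: "K (E u) = qp_scale (Q 2) (E (K u))"
proof (rule qlinear_eq_on_mon[of "\<lambda>u. K (E u)"])
  fix m n :: int
  have "Q (m + 1 - (n - 1)) = Q 2 * Q (m - n)"
    by (simp only: Q_add[symmetric], rule arg_cong[of _ _ Q], simp)
  then show "K (E (mon m n)) = qp_scale (Q 2) (E (K (mon m n)))"
    by (simp only: mon_simps qlin_scale qp.scale_scale mult_ac)
qed (intro qlinear_intros)+

lemma K_F: "K (F u) = qp_scale (Q (-2)) (F (K u))"
proof (rule qlinear_eq_on_mon[of "\<lambda>u. K (F u)"])
  fix m n :: int
  have "Q (m - 1 - (n + 1)) = Q (-2) * Q (m - n)"
    by (simp only: Q_add[symmetric], rule arg_cong[of _ _ Q], simp)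
  then show "K (F (mon m n)) = qp_scale (Q (-2)) (F (K (mon m n)))"
    by (simp only: mon_simps qlin_scale qp.scale_scale mult_ac)
qed (intro qlinear_intros)+

lemma Ki_E: "Ki (E u) = qp_scale (Q (-2)) (E (Ki u))"
proof -
  have "Ki (E u) = Ki (qp_scale (Q (-2)) (qp_scale (Q 2) (E (K (Ki u)))))"
    by (simp flip: Q_add)
  also have "\<dots> = qp_scale (Q (-2)) (Ki (K (E (Ki u))))"
    by (simp only: K_E qlin_scale)
  finally show ?thesis by simp
qed

lemma E_F: "E (F u) - F (E u) = qp_scale (1 / (Q 1 - Q (-1))) (K u - Ki u)"
proof (rule qlinear_eq_on_mon[of "\<lambda>u. E (F u) - F (E u)"])
  fix m n :: int
  \<comment> \<open>After expansion by \<open>N_Suc\<close> the cross terms q [m] [n]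
    cancel.\<close>
  have "N (n + 1) * N m - N (m + 1) * N n = Q (- n) * N m - Q (- m) * N n"
    by (simp only: N_Suc(1)[of m] N_Suc(1)[of n]) (simp add: algebra_simps)
  moreover have "(Q (- n) * N m - Q (- m) * N n) * (Q 1 - Q (-1)) = Q (m - n) - Q (n - m)"
    by (simp add: left_diff_distrib mult.assoc N_mult) (simp add: Q_diff Q_minus field_simps)
  then have "Q (- n) * N m - Q (- m) * N n = 1 / (Q 1 - Q (-1)) * (Q (m - n) - Q (n - m))"
    using Q1_diff_nonzero by (simp add: eq_divide_eq)
  ultimately have 1: "N (n + 1) * N m - N (m + 1) * N n = 1 / (Q 1 - Q (-1)) * (Q (m - n) - Q (n - m))" by simp
  have 2: "m - 1 + 1 = m" "n + 1 - 1 = n" "m + 1 - 1 = m" "n - 1 + 1 = n" by simp_all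
  show "E (F (mon m n)) - F (E (mon m n)) = qp_scale (1 / (Q 1 - Q (-1))) (K (mon m n) - Ki (mon m n))"
    by (simp only: mon_simps qlin_scale qp.scale_scale 2 qp.scale_left_diff_distrib[symmetric] 1)
qed (intro qlinear_intros)+

lemma funpow_E_mon: "(E ^^ k) (mon m n) = qp_scale (\<Prod>i<k. N (m + 1 + int i)) (mon (m + int k) (n - int k))"
  by (induction k) (simp_all add: mon_simps qlin_scale algebra_simps)

lemma funpow_F_mon: "(F ^^ k) (mon m n) = qp_scale (\<Prod>i<k. N (n + 1 + int i)) (mon (m - int k) (n + int k))"
  by (induction k) (simp_all add: mon_simps qlin_scale algebra_simps)

lemma prod_N_eq_0: "(\<Prod>i<p. N (m + 1 + int i)) = 0"
proof -
  \<comment> \<open>Among the p consecutive integers m+1, ..., m+p this index picks the multiple of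
    p, whose q-number vanishes.\<close>
  define i where "i = nat ((- (m + 1)) mod int p)"
  have p: "int p > 0" using p_ge_2 by simp
  then have "i < p" unfolding i_def by (simp add: nat_less_iff)
  moreover have "int p dvd m + 1 + int i"
  proof -
    have "int i = (- (m + 1)) mod int p" using p by (simp add: i_def)
    then have "(m + 1 + int i) mod int p = (m + 1 + - (m + 1)) mod int p"
      by (simp only: mod_add_right_eq)
    then show ?thesis by (simp add: dvd_eq_mod_eq_0)
  qed
  ultimately show ?thesis by (intro prod_zero) (auto simp: N_eq_0 intro!: bexI[of _ i])
qed

lemma qlinear_funpow: "qlinear f \<Longrightarrow> qlinear (f ^^ k)"
  by (induction k) (auto simp: id_def qlinear_ident qlinear_compose)

lemma qlinear_zero: "qlinear (\<lambda>u. 0)"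
  by (rule qpp.module_hom_zero)

lemma funpow_E_p: "(E ^^ p) u = 0"
  by (rule qlinear_eq_on_mon[of "E ^^ p" "\<lambda>u. 0"])
    (simp_all add: qlinear_funpow qlinear_ops qlinear_zero funpow_E_mon prod_N_eq_0)

lemma funpow_F_p: "(F ^^ p) u = 0"
  by (rule qlinear_eq_on_mon[of "F ^^ p" "\<lambda>u. 0"])
    (simp_all add: qlinear_funpow qlinear_ops qlinear_zero funpow_F_mon prod_N_eq_0)

lemma funpow_K_mon: "(K ^^ k) (mon m n) = qp_scale (Q (m - n) ^ k) (mon m n)"
  by (induction k) (simp_all add: mon_simps qlin_scale mult_ac)

lemma funpow_K_2p: "(K ^^ (2 * p)) u = u"
proof (rule qlinear_eq_on_mon[of "K ^^ (2 * p)" "\<lambda>u. u"])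
  fix m n :: int
  have "Q (m - n) ^ (2 * p) = (qpar p powi (m - n)) powi (2 * int p)"
    unfolding Q_def by (simp flip: power_int_of_nat)
  also have "\<dots> = (qpar p powi (2 * int p)) powi (m - n)"
    by (simp only: power_int_mult[symmetric] mult.commute)
  finally show "(K ^^ (2 * p)) (mon m n) = mon m n"
    using Q_2p by (simp add: funpow_K_mon Q_def)
qed (simp_all add: qlinear_funpow qlinear_ops qlinear_ident)

subsection \<open>The algebra of quantum differential operators\<close>

lemma op_scale_apply: "op_scale c T u = qp_scale c (T u)"
  by (simp add: op_scale_def)

text \<open>Integer exponents keep the family closed under the commutation relations, which produce
  \<open>m - 1\<close> and \<open>n - 1\<close>; negative exponents give the zero operator.\<close>

definition basis_op :: "int \<Rightarrow> int \<Rightarrow> nat \<Rightarrow> nat \<Rightarrow> qop"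
  where "basis_op m n a b = qp_mult p (mon m n) \<circ> (dx p ^^ a) \<circ> (dy p ^^ b)"

lemma basis_op_in_qdiff_ops: "basis_op m n a b \<in> qdiff_ops p"
proof (cases "m < 0 \<or> n < 0")
  case True
  then have "basis_op m n a b = 0"
    by (simp add: basis_op_def qp_mult_zero_left fun_eq_iff)
  then show ?thesis by (simp add: qdiff_ops_def qop.span_zero)
next
  case False
  then obtain m' n' where "m = int m'" "n = int n'"
    by (metis nonneg_int_cases not_le)
  then show ?thesis unfolding qdiff_ops_def basis_op_def by (intro qop.span_base) blast
qed

lemma qdiff_ops_closed:
  "0 \<in> qdiff_ops p"
  "S \<in> qdiff_ops p \<Longrightarrow> T \<in> qdiff_ops p \<Longrightarrow> S + T \<in> qdiff_ops p"
  "S \<in> qdiff_ops p \<Longrightarrow> op_scale c S \<in> qdiff_ops p"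
  unfolding qdiff_ops_def by (simp_all add: qop.span_zero qop.span_add qop.span_scale)

lemma qdiff_ops_span_induct [consumes 1, case_names zero add scale basis]:
  assumes "T \<in> qdiff_ops p"
    and zero: "P 0" and add: "\<And>S T. P S \<Longrightarrow> P T \<Longrightarrow> P (S + T)"
    and scale: "\<And>c T. P T \<Longrightarrow> P (op_scale c T)"
    and basis: "\<And>m n a b. P (basis_op m n a b)"
  shows "P T"
proof -
  have "qop.subspace {T. P T}"
    using zero add scale by (auto intro: qop.subspaceI)
  with assms(1) show ?thesis
    unfolding qdiff_ops_def
    by (rule qop.span_induct) (use basis in \<open>auto simp: basis_op_def\<close>)
qed

lemma qlinear_qdiff_ops: "T \<in> qdiff_ops p \<Longrightarrow> qlinear T"
proof (induction rule: qdiff_ops_span_induct)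
  case zero
  show ?case unfolding zero_fun_def by (rule qlinear_zero)
next
  case (add S T)
  then show ?case unfolding plus_fun_def by (rule qpp.module_hom_add)
next
  case (scale c T)
  then show ?case unfolding op_scale_def by (rule qpp.module_hom_scale)
next
  case (basis m n a b)
  show ?case
    unfolding basis_op_def by (intro qlinear_compose qlinear_funpow qlinear_ops qlinear_qp_mult)
qed

text \<open>Commuting a derivative past a monomial can leave a \<open>dy\<close> to the left of
  \<open>dx p ^^ a\<close>; this restores the normal order.\<close>

lemma dy_funpow_dx: "dy p ((dx p ^^ a) u) = qp_scale (Q (-1) ^ a) ((dx p ^^ a) (dy p u))"
  by (induction a) (simp_all add: dy_dx qlin_scale mult_ac)

lemma mult_basis_op: "qp_mult p (mon m n) \<circ> basis_op r s a b \<in> qdiff_ops p"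
proof -
  have "qp_mult p (mon m n) \<circ> basis_op r s a b
      = op_scale (Q (n * r) * B m r * B n s) (basis_op (m + r) (n + s) a b)"
    by (simp add: fun_eq_iff basis_op_def op_scale_apply mult_mon_mult)
  then show ?thesis by (simp add: qdiff_ops_closed basis_op_in_qdiff_ops)
qed

lemma dx_basis_op: "dx p \<circ> basis_op m n a b \<in> qdiff_ops p"
proof -
  have "dx p \<circ> basis_op m n a b
      = op_scale (Q (- 2 * m - n)) (basis_op m n (Suc a) b)
        + op_scale (Q (- m - 2 * n + 1)) (basis_op (m - 1) n a b)
        + op_scale (Q (- m - 2 * n - 1) * (1 - Q 2) * N (n + 1) * Q (-1) ^ a) (basis_op (m - 1) (n + 1) a (Suc b))"
    by (simp add: fun_eq_iff basis_op_def op_scale_apply dx_mult dy_funpow_dx qlin_scale)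
  then show ?thesis by (simp add: qdiff_ops_closed basis_op_in_qdiff_ops)
qed

lemma dy_basis_op: "dy p \<circ> basis_op m n a b \<in> qdiff_ops p"
proof -
  have "dy p \<circ> basis_op m n a b
      = op_scale (Q (- m - 2 * n) * Q (-1) ^ a) (basis_op m n a (Suc b))
        + op_scale (Q (- m - n + 1)) (basis_op m (n - 1) a b)"
    by (simp add: fun_eq_iff basis_op_def op_scale_apply dy_mult dy_funpow_dx qlin_scale)
  then show ?thesis by (simp add: qdiff_ops_closed basis_op_in_qdiff_ops)
qed

lemma comp_left_in_qdiff_ops:
  assumes "qlinear X" "\<And>m n a b. X \<circ> basis_op m n a b \<in> qdiff_ops p" "T \<in> qdiff_ops p"
  shows "X \<circ> T \<in> qdiff_ops p"
  using assms(3)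
proof (induction rule: qdiff_ops_span_induct)
  case zero
  have "X \<circ> 0 = (0 :: qop)" by (simp add: fun_eq_iff module_hom.zero[OF assms(1)])
  then show ?case by (simp only: qdiff_ops_closed)
next
  case (add S T)
  have "X \<circ> (S + T) = (X \<circ> S) + (X \<circ> T)" by (simp add: fun_eq_iff module_hom.add[OF assms(1)])
  with add show ?case by (simp only: qdiff_ops_closed)
next
  case (scale c T)
  have "X \<circ> op_scale c T = op_scale c (X \<circ> T)"
    by (simp add: fun_eq_iff op_scale_apply module_hom.scale[OF assms(1)])
  with scale show ?case by (simp only: qdiff_ops_closed)
qed (rule assms(2))

text \<open>The algebra is defined as a span only, so closure under composition has to be derived. A
  spanning operator is a chain of multiplications and derivatives, and the commutation relations
  return each of these, composed from the left, to normal order.\<close>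

lemma comp_in_qdiff_ops:
  assumes "S \<in> qdiff_ops p" "T \<in> qdiff_ops p"
  shows "S \<circ> T \<in> qdiff_ops p"
  using assms(1)
proof (induction rule: qdiff_ops_span_induct)
  case zero
  have "(0 :: qop) \<circ> T = 0" by (simp add: fun_eq_iff)
  then show ?case by (simp only: qdiff_ops_closed)
next
  case (add R S)
  have "(R + S) \<circ> T = (R \<circ> T) + (S \<circ> T)" by (simp add: fun_eq_iff)
  with add show ?case by (simp only: qdiff_ops_closed)
next
  case (scale c S)
  have "op_scale c S \<circ> T = op_scale c (S \<circ> T)"
    by (simp add: fun_eq_iff op_scale_apply)
  with scale show ?case by (simp only: qdiff_ops_closed)
next
  case (basis m n a b)
  have dy: "(dy p ^^ b) \<circ> T \<in> qdiff_ops p"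
  proof (induction b)
    case (Suc b)
    then show ?case
      unfolding funpow.simps comp_assoc by (rule comp_left_in_qdiff_ops[OF qlinear_ops(6) dy_basis_op])
  qed (simp only: funpow.simps id_comp assms(2))
  have "(dx p ^^ a) \<circ> ((dy p ^^ b) \<circ> T) \<in> qdiff_ops p"
  proof (induction a)
    case (Suc a)
    then show ?case
      unfolding funpow.simps comp_assoc by (rule comp_left_in_qdiff_ops[OF qlinear_ops(5) dx_basis_op])
  qed (simp only: funpow.simps id_comp dy)
  then show ?case
    unfolding basis_op_def comp_assoc
    by (rule comp_left_in_qdiff_ops[OF qlinear_qp_mult mult_basis_op])
qed

lemma mult_mon_in_qdiff_ops: "qp_mult p (mon m n) \<in> qdiff_ops p"
  using basis_op_in_qdiff_ops[of m n 0 0] by (simp add: basis_op_def)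

lemma mult_mon_00: "qp_mult p (mon 0 0) = id"
  by (simp add: fun_eq_iff mon_00_mult)

lemma id_in_qdiff_ops: "id \<in> qdiff_ops p"
  using mult_mon_in_qdiff_ops[of 0 0] by (simp add: mult_mon_00)

lemma dx_in_qdiff_ops: "dx p \<in> qdiff_ops p" and dy_in_qdiff_ops: "dy p \<in> qdiff_ops p"
  using basis_op_in_qdiff_ops[of 0 0 1 0] basis_op_in_qdiff_ops[of 0 0 0 1]
  by (simp_all add: basis_op_def comp_def mon_00_mult)

lemma mult_in_qdiff_ops: "qp_mult p a \<in> qdiff_ops p"
proof (induction a rule: poly_mapping_add_induct)
  case (single k c)
  show ?case
    by (cases k) (simp add: single_conv_mon qp_mult_scale_left qdiff_ops_closed mult_mon_in_qdiff_ops)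
next
  case (add f g)
  then show ?case unfolding qp_mult_add_left by (rule qdiff_ops_closed)
qed

text \<open>Serves both stability under the adjoint action and uniqueness. The identity has no case
  of its own, being multiplication by the monomial with exponents 0; carrying membership along
  provides linear factors in the composition case.\<close>

lemma qdiff_ops_induct [consumes 1, case_names zero add scale comp mult dx dy]:
  assumes "T \<in> qdiff_ops p"
    and zero: "P 0"
    and add: "\<And>S T. S \<in> qdiff_ops p \<Longrightarrow> T \<in> qdiff_ops p \<Longrightarrow> P S \<Longrightarrow> P T \<Longrightarrow> P (S + T)"
    and scale: "\<And>c T. T \<in> qdiff_ops p \<Longrightarrow> P T \<Longrightarrow> P (op_scale c T)"
    and comp: "\<And>S T. S \<in> qdiff_ops p \<Longrightarrow> T \<in> qdiff_ops p \<Longrightarrow> P S \<Longrightarrow> P T \<Longrightarrow> P (S \<circ> T)"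
    and mult: "\<And>a. P (qp_mult p a)" and dx: "P (dx p)" and dy: "P (dy p)"
  shows "P T"
proof -
  have "T \<in> qdiff_ops p \<and> P T"
    using assms(1)
  proof (induction rule: qdiff_ops_span_induct)
    case (basis m n a b)
    have 1: "P id"
      using mult[of "mon 0 0"] by (simp only: mult_mon_00)
    have 2: "dx p ^^ a \<in> qdiff_ops p \<and> P (dx p ^^ a)" for a
      by (induction a)
        (simp_all only: funpow.simps 1 id_in_qdiff_ops comp comp_in_qdiff_ops dx dx_in_qdiff_ops simp_thms)
    have 3: "dy p ^^ b \<in> qdiff_ops p \<and> P (dy p ^^ b)" for b
      by (induction b)
        (simp_all only: funpow.simps 1 id_in_qdiff_ops comp comp_in_qdiff_ops dy dy_in_qdiff_ops simp_thms)
    show ?case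
      using 2 3 unfolding basis_op_def
      by (intro conjI comp comp_in_qdiff_ops mult mult_in_qdiff_ops) auto
  qed (blast intro: qdiff_ops_closed zero add scale)+
  then show ?thesis by blast
qed

end

interpretation qopp: module_pair op_scale op_scale ..

abbreviation oplinear :: "(qop \<Rightarrow> qop) \<Rightarrow> bool"
  where "oplinear \<equiv> module_hom op_scale op_scale"

context root_param
begin

subsection \<open>The adjoint action\<close>

text \<open>\<open>ad\<close> is $T \mapsto \sum h' \circ T \circ S(h'')$ for the generators $h$.\<close>

definition ad :: "gen \<Rightarrow> qop \<Rightarrow> qop"
  where "ad g T = (case g of
      GE \<Rightarrow> (\<lambda>u. E (T (Ki u)) - T (E (Ki u)))
    | GF \<Rightarrow> (\<lambda>u. F (T u) - Ki (T (K (F u))))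
    | GK \<Rightarrow> (\<lambda>u. K (T (Ki u)))
    | GKinv \<Rightarrow> (\<lambda>u. Ki (T (K u))))"

lemma ad_simps:
  "ad GE T u = E (T (Ki u)) - T (E (Ki u))"
  "ad GF T u = F (T u) - Ki (T (K (F u)))"
  "ad GK T u = K (T (Ki u))"
  "ad GKinv T u = Ki (T (K u))"
  by (simp_all add: ad_def)

lemmas qlin_add = qlinear_ops[THEN module_hom.add]
lemmas qlin_diff = qlinear_ops[THEN module_hom.diff]

lemma oplinear_ad: "oplinear (ad g)"
proof
  show "ad g (S + T) = ad g S + ad g T" for S T
    by (cases g) (simp_all add: fun_eq_iff ad_simps qlin_add)
  show "ad g (op_scale c T) = op_scale c (ad g T)" for c T
    by (cases g) (simp_all add: fun_eq_iff ad_simps op_scale_apply qlin_scale qp.scale_right_diff_distrib)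
qed

lemma qlinear_ad:
  assumes "qlinear T"
  shows "qlinear (ad g T)"
  by (cases g; simp only: ad_def gen.case;
      intro qlinear_intros assms[THEN qlinear_compose[unfolded comp_def, rotated]])

text \<open>With K^(-1) K = 1 the intermediate terms cancel, for E the term S E T K^(-1) and for F
  the term K^(-1) S K F T. Linearity of \<open>S\<close> lets it pass through the difference inside
  the second adjoint action.\<close>

lemma ad_comp:
  assumes "qlinear S"
  shows "ad GE (S \<circ> T) = (ad GE S \<circ> ad GK T) + (S \<circ> ad GE T)"
    and "ad GF (S \<circ> T) = (ad GF S \<circ> T) + (ad GKinv S \<circ> ad GF T)"
    and "ad GK (S \<circ> T) = ad GK S \<circ> ad GK T"
    and "ad GKinv (S \<circ> T) = ad GKinv S \<circ> ad GKinv T"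
  by (simp_all add: fun_eq_iff ad_simps module_hom.diff[OF assms] qlin_diff)

text \<open>For E and F the coproduct rules of the plane produce an extra term in which the
  generator acts on the argument u, and the subtracted part of the adjoint action removes
  it.\<close>

lemma ad_mult:
  "ad GE (qp_mult p a) = qp_mult p (E a)"
  "ad GF (qp_mult p a) = qp_mult p (F a)"
  "ad GK (qp_mult p a) = qp_mult p (K a)"
  "ad GKinv (qp_mult p a) = qp_mult p (Ki a)"
  by (simp_all add: fun_eq_iff ad_simps E_mult F_mult K_mult Ki_mult)

lemma ad_id: "ad GE id = 0" "ad GF id = 0" "ad GK id = id" "ad GKinv id = id"
  by (simp_all add: fun_eq_iff ad_simps)

lemma qop_eq_on_mon:
  assumes "qlinear S" "qlinear T" "\<And>m n. S (mon m n) = T (mon m n)"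
  shows "S = T"
  by (rule ext, rule qlinear_eq_on_mon[OF assms])

lemma qlinear_op_scale: "qlinear T \<Longrightarrow> qlinear (op_scale c T)"
  unfolding op_scale_def by (rule qpp.module_hom_scale)

lemma qlinear_0: "qlinear 0"
  unfolding zero_fun_def by (rule qlinear_zero)

lemma ad_dx:
  "ad GE (dx p) = op_scale (- qpar p) (dy p)"
  "ad GF (dx p) = 0"
  "ad GK (dx p) = op_scale (inverse (qpar p)) (dx p)"
  "ad GKinv (dx p) = op_scale (qpar p) (dx p)"
proof -
  note lin = qlinear_ad qlinear_ops qlinear_op_scale qlinear_0
  have q: "qpar p = Q 1" "inverse (Q 1) = Q (-1)"
    by (simp_all add: Q_def power_int_minus)
  show "ad GE (dx p) = op_scale (- qpar p) (dy p)"
  proof (rule qop_eq_on_mon)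
    fix m n
    \<comment> \<open>Both parts of the adjoint action land in the same monomial; expanding [m+1] by
      \<open>N_Suc\<close> cancels [m] and leaves a power of q.\<close>
    have 1: "Q (n - m) * Q (- m - 2 * n + 1) * N m - Q (n - m) * Q (- (m + 1) - 2 * (n - 1) + 1) * N (m + 1)
        = - Q 1 * Q (- m - n + 1)"
    proof -
      have a: "Q (n - m) * Q (- (m + 1) - 2 * (n - 1) + 1) * Q (-1) = Q (n - m) * Q (- m - 2 * n + 1)"
        by (simp only: Q_add[symmetric]) (rule arg_cong[of _ _ Q], simp)
      have b: "Q (n - m) * Q (- (m + 1) - 2 * (n - 1) + 1) * Q m = Q 1 * Q (- m - n + 1)"
        by (simp only: Q_add[symmetric]) (rule arg_cong[of _ _ Q], simp)
      show ?thesis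
        by (simp only: N_Suc(2)[of m] distrib_left mult.assoc[symmetric] a b) simp
    qed
    have 2: "m - 1 + 1 = m" "m + 1 - 1 = m" by simp_all
    have "ad GE (dx p) (mon m n)
      = qp_scale (Q (n - m) * Q (- m - 2 * n + 1) * N m - Q (n - m) * Q (- (m + 1) - 2 * (n - 1) + 1) * N (m + 1)) (mon m (n - 1))"
      by (simp only: ad_simps mon_simps qlin_scale qp.scale_scale 2 qp.scale_left_diff_distrib mult_ac)
    then show "ad GE (dx p) (mon m n) = op_scale (- qpar p) (dy p) (mon m n)"
      by (simp only: 1 op_scale_apply mon_simps qp.scale_scale q)
  qed (intro lin)+
  show "ad GF (dx p) = 0"
  proof (rule qop_eq_on_mon)
    fix m n
    have 1: "Q (m - 1 - (n + 1)) * Q (- (m - 1) - 2 * (n + 1) + 1) * Q (n + 1 - (m - 1 - 1)) = Q (- m - 2 * n + 1)"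
      by (simp only: Q_add[symmetric]) (rule arg_cong[of _ _ Q], simp)
    have "ad GF (dx p) (mon m n)
      = qp_scale (Q (- m - 2 * n + 1) * N (n + 1)) (mon (m - 1 - 1) (n + 1))
       - qp_scale (Q (m - 1 - (n + 1)) * Q (- (m - 1) - 2 * (n + 1) + 1) * Q (n + 1 - (m - 1 - 1)) * N (n + 1)) (mon (m - 1 - 1) (n + 1))"
      by (simp only: ad_simps mon_simps qlin_scale qp.scale_scale mult_ac)
    then show "ad GF (dx p) (mon m n) = 0 (mon m n)"
      by (simp only: 1) simp
  qed (intro lin)+
  show "ad GK (dx p) = op_scale (inverse (qpar p)) (dx p)"
  proof (rule qop_eq_on_mon)
    fix m n
    have "Q (n - m) * Q (- m - 2 * n + 1) * Q (m - 1 - n) = Q (-1) * Q (- m - 2 * n + 1)"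
      by (simp only: Q_add[symmetric]) (rule arg_cong[of _ _ Q], simp)
    then show "ad GK (dx p) (mon m n) = op_scale (inverse (qpar p)) (dx p) (mon m n)"
      by (simp only: ad_simps mon_simps qlin_scale qp.scale_scale op_scale_apply q)
  qed (intro lin)+
  show "ad GKinv (dx p) = op_scale (qpar p) (dx p)"
  proof (rule qop_eq_on_mon)
    fix m n
    have "Q (m - n) * Q (- m - 2 * n + 1) * Q (n - (m - 1)) = Q 1 * Q (- m - 2 * n + 1)"
      by (simp only: Q_add[symmetric]) (rule arg_cong[of _ _ Q], simp)
    then show "ad GKinv (dx p) (mon m n) = op_scale (qpar p) (dx p) (mon m n)"
      by (simp only: ad_simps mon_simps qlin_scale qp.scale_scale op_scale_apply q)
  qed (intro lin)+
qed

lemma ad_dy: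
  "ad GE (dy p) = 0"
  "ad GF (dy p) = op_scale (- inverse (qpar p)) (dx p)"
  "ad GK (dy p) = op_scale (qpar p) (dy p)"
  "ad GKinv (dy p) = op_scale (inverse (qpar p)) (dy p)"
proof -
  note lin = qlinear_ad qlinear_ops qlinear_op_scale qlinear_0
  have q: "qpar p = Q 1" "inverse (Q 1) = Q (-1)"
    by (simp_all add: Q_def power_int_minus)
  show "ad GE (dy p) = 0"
  proof (rule qop_eq_on_mon)
    fix m n
    have 1: "Q (n - m) * Q (- (m + 1) - (n - 1) + 1) = Q (n - m) * Q (- m - n + 1)"
      by (simp only: Q_add[symmetric]) (rule arg_cong[of _ _ Q], simp)
    have "ad GE (dy p) (mon m n)
      = qp_scale (Q (n - m) * Q (- m - n + 1) * N (m + 1)) (mon (m + 1) (n - 1 - 1))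
       - qp_scale (Q (n - m) * Q (- (m + 1) - (n - 1) + 1) * N (m + 1)) (mon (m + 1) (n - 1 - 1))"
      by (simp only: ad_simps mon_simps qlin_scale qp.scale_scale mult_ac)
    then show "ad GE (dy p) (mon m n) = 0 (mon m n)"
      by (simp only: 1) simp
  qed (intro lin)+
  show "ad GF (dy p) = op_scale (- inverse (qpar p)) (dx p)"
  proof (rule qop_eq_on_mon)
    fix m n
    have 1: "Q (- m - n + 1) * N n
        - Q (m - 1 - (n + 1)) * Q (- (m - 1) - (n + 1) + 1) * Q (n - (m - 1)) * N (n + 1)
        = - Q (-1) * Q (- m - 2 * n + 1)"
    proof -
      have a: "Q (m - 1 - (n + 1)) * Q (- (m - 1) - (n + 1) + 1) * Q (n - (m - 1)) * Q 1 = Q (- m - n + 1)"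
        by (simp only: Q_add[symmetric]) (rule arg_cong[of _ _ Q], simp)
      have b: "Q (m - 1 - (n + 1)) * Q (- (m - 1) - (n + 1) + 1) * Q (n - (m - 1)) * Q (- n)
          = Q (-1) * Q (- m - 2 * n + 1)"
        by (simp only: Q_add[symmetric]) (rule arg_cong[of _ _ Q], simp)
      show ?thesis
        by (simp only: N_Suc(1)[of n] distrib_left mult.assoc[symmetric] a b) simp
    qed
    have 2: "n - 1 + 1 = n" "n + 1 - 1 = n" by simp_all
    have "ad GF (dy p) (mon m n) = qp_scale (Q (- m - n + 1) * N n
        - Q (m - 1 - (n + 1)) * Q (- (m - 1) - (n + 1) + 1) * Q (n - (m - 1)) * N (n + 1)) (mon (m - 1) n)"
      by (simp only: ad_simps mon_simps qlin_scale qp.scale_scale 2 qp.scale_left_diff_distrib mult_ac)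
    then show "ad GF (dy p) (mon m n) = op_scale (- inverse (qpar p)) (dx p) (mon m n)"
      by (simp only: 1 op_scale_apply mon_simps qp.scale_scale q)
  qed (intro lin)+
  show "ad GK (dy p) = op_scale (qpar p) (dy p)"
  proof (rule qop_eq_on_mon)
    fix m n
    have "Q (n - m) * Q (- m - n + 1) * Q (m - (n - 1)) = Q 1 * Q (- m - n + 1)"
      by (simp only: Q_add[symmetric]) (rule arg_cong[of _ _ Q], simp)
    then show "ad GK (dy p) (mon m n) = op_scale (qpar p) (dy p) (mon m n)"
      by (simp only: ad_simps mon_simps qlin_scale qp.scale_scale op_scale_apply q)
  qed (intro lin)+
  show "ad GKinv (dy p) = op_scale (inverse (qpar p)) (dy p)"
  proof (rule qop_eq_on_mon)
    fix m n
    have "Q (m - n) * Q (- m - n + 1) * Q (n - 1 - m) = Q (-1) * Q (- m - n + 1)"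
      by (simp only: Q_add[symmetric]) (rule arg_cong[of _ _ Q], simp)
    then show "ad GKinv (dy p) (mon m n) = op_scale (inverse (qpar p)) (dy p) (mon m n)"
      by (simp only: ad_simps mon_simps qlin_scale qp.scale_scale op_scale_apply q)
  qed (intro lin)+
qed

lemma ad_in_qdiff_ops:
  assumes "T \<in> qdiff_ops p"
  shows "ad g T \<in> qdiff_ops p"
proof -
  \<comment> \<open>All four generators are treated at once, since the coproduct of E brings in K
    and that of F brings in K^(-1).\<close>
  have "\<forall>g. ad g T \<in> qdiff_ops p"
    using assms
  proof (induction rule: qdiff_ops_induct)
    case zero
    show ?case unfolding module_hom.zero[OF oplinear_ad] by (blast intro: qdiff_ops_closed)
  next
    case (add S T)
    then show ?case unfolding module_hom.add[OF oplinear_ad] by (blast intro: qdiff_ops_closed)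
  next
    case (scale c T)
    then show ?case unfolding module_hom.scale[OF oplinear_ad] by (blast intro: qdiff_ops_closed)
  next
    case (comp S T)
    show ?case
    proof
      fix g
      show "ad g (S \<circ> T) \<in> qdiff_ops p"
        by (cases g; simp only: ad_comp[OF qlinear_qdiff_ops[OF comp(1)]];
            intro qdiff_ops_closed comp_in_qdiff_ops; use comp in blast)
    qed
  next
    case (mult a)
    show ?case
    proof
      show "ad g (qp_mult p a) \<in> qdiff_ops p" for g
        by (cases g; simp only: ad_mult mult_in_qdiff_ops)
    qed
  next
    case dx
    show ?case
    proof
      show "ad g (dx p) \<in> qdiff_ops p" for g
        by (cases g; simp only: ad_dx qdiff_ops_closed dx_in_qdiff_ops dy_in_qdiff_ops)
    qed
  next
    case dy
    show ?case
    proof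
      show "ad g (dy p) \<in> qdiff_ops p" for g
        by (cases g; simp only: ad_dy qdiff_ops_closed dx_in_qdiff_ops dy_in_qdiff_ops)
    qed
  qed
  then show ?thesis by blast
qed

subsection \<open>The relations of $U$ hold for the adjoint action\<close>

lemma ad_GK_GKinv: "ad GK (ad GKinv T) = T" "ad GKinv (ad GK T) = T"
  by (simp_all add: fun_eq_iff ad_simps)

lemma ad_K_conj:
  assumes "qlinear T"
  shows "ad GK (ad GE (ad GKinv T)) = op_scale (Q 2) (ad GE T)"
    and "ad GK (ad GF (ad GKinv T)) = op_scale (Q (-2)) (ad GF T)"
  by (simp_all add: fun_eq_iff ad_simps op_scale_apply qlin_diff K_E K_F qlin_scale
      module_hom.scale[OF assms] qp.scale_right_diff_distrib)

text \<open>The commutator of E and F to the left of T gives K T K^(-1) - K^(-1) T K^(-1), and to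
  the right K^(-1) T K - K^(-1) T K^(-1), so K^(-1) T K^(-1) drops out of the difference. The mixed
  terms, with E on one side of T and F on the other, cancel because commuting K^(-1) with E and K
  with F costs the same factor q^(-2).\<close>

lemma ad_E_F:
  assumes "qlinear T"
  shows "ad GE (ad GF T) - ad GF (ad GE T) = op_scale (1 / (Q 1 - Q (-1))) (ad GK T - ad GKinv T)"
proof
  fix u
  let ?c = "1 / (Q 1 - Q (-1))"
  note T_diff = module_hom.diff[OF assms] and T_scale = module_hom.scale[OF assms]
  have KF: "K (F (E (Ki w))) = F (E w)" for w
    by (simp add: K_E K_F qlin_scale flip: Q_add)
  have KF': "K (F (Ki w)) = qp_scale (Q (-2)) (F w)" for w
    by (simp add: K_F)
  have "(ad GE (ad GF T) - ad GF (ad GE T)) u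
      = (E (F (T (Ki u))) - F (E (T (Ki u)))) - (Ki (T (E (F u))) - Ki (T (F (E u))))
        + (Ki (E (T (F u))) - E (Ki (T (K (F (Ki u))))))"
    by (simp add: ad_simps qlin_diff KF algebra_simps)
  also have "Ki (E (T (F u))) - E (Ki (T (K (F (Ki u))))) = 0"
    by (simp add: KF' T_scale qlin_scale Ki_E)
  also have "Ki (T (E (F u))) - Ki (T (F (E u))) = qp_scale ?c (Ki (T (K u)) - Ki (T (Ki u)))"
    by (simp only: T_diff[symmetric] qlin_diff[symmetric] E_F T_scale qlin_scale)
  also have "E (F (T (Ki u))) - F (E (T (Ki u))) = qp_scale ?c (K (T (Ki u)) - Ki (T (Ki u)))"
    by (rule E_F)
  finally show "(ad GE (ad GF T) - ad GF (ad GE T)) u = op_scale ?c (ad GK T - ad GKinv T) u"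
    by (simp add: ad_simps op_scale_apply qp.scale_right_diff_distrib)
qed

lemma ad_K_2p:
  assumes "qlinear T"
  shows "(ad GK ^^ (2 * p)) T = T"
proof
  fix u
  have 1: "(ad GK ^^ n) T u = (K ^^ n) (T ((Ki ^^ n) u))" for n u
    by (induction n arbitrary: u) (simp_all add: ad_simps funpow_swap1[of Ki])
  have 2: "(K ^^ n) ((Ki ^^ n) u) = u" for n u
    by (induction n arbitrary: u) (simp_all add: funpow_swap1[of Ki])
  have "(Ki ^^ (2 * p)) u = u"
    using funpow_K_2p[of "(Ki ^^ (2 * p)) u"] 2[of "2 * p" u] by simp
  then show "(ad GK ^^ (2 * p)) T u = T u"
    by (simp add: 1 funpow_K_2p)
qed

subsection \<open>Nilpotency\<close>

text \<open>By \<open>B_step\<close>, [k] times the coefficient is a multiple of [p] = 0, while [k]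
  is nonzero for 0 < k < p.\<close>

lemma B_p: "0 < k \<Longrightarrow> k < p \<Longrightarrow> B (int k) (int p - int k) = 0"
  using B_step(1)[of "int k" "int p - int k"] N_nonzero[of k] N_eq_0[of "int p"] by simp

text \<open>In the symmetric normalization of [n], normal ordering to L^k R^(n-k) gives [n choose k]
  the extra factor q^(\<tau> k (n-k)). The sign \<tau> treats E and F together, whose two parts
  commute up to q^(-2) and q^2 respectively. The commutation is assumed on linear operators only, as
  for E it moves a scalar through \<open>S\<close>.\<close>

lemma q_binomial_theorem:
  fixes L R :: "qop \<Rightarrow> qop"
  assumes \<tau>: "\<tau> = 1 \<or> \<tau> = -1"
    and lin: "oplinear L" "oplinear R"
    and pres: "\<And>S. qlinear S \<Longrightarrow> qlinear (L S)" "\<And>S. qlinear S \<Longrightarrow> qlinear (R S)"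
    and comm: "\<And>S. qlinear S \<Longrightarrow> R (L S) = op_scale (Q (2 * \<tau>)) (L (R S))"
    and T: "qlinear T"
  shows "((\<lambda>S. L S + R S) ^^ n) T
    = (\<Sum>k\<le>n. op_scale (Q (\<tau> * int k * (int n - int k)) * B (int k) (int n - int k)) ((L ^^ k) ((R ^^ (n - k)) T)))"
proof (induction n)
  case 0
  show ?case by (simp add: B_0_left)
next
  case (Suc n)
  let ?g = "\<lambda>k j. Q (\<tau> * k * j) * B k j"
  let ?X = "\<lambda>k. (L ^^ k) ((R ^^ (Suc n - k)) T)"
  have qR: "qlinear ((R ^^ j) T)" for j
    by (induction j) (simp_all add: T pres)
  have qL: "qlinear S \<Longrightarrow> qlinear ((L ^^ k) S)" for k S
    by (induction k) (simp_all add: pres)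
  have RL: "R ((L ^^ k) S) = op_scale (Q (2 * \<tau> * int k)) ((L ^^ k) (R S))" if "qlinear S" for k S
  proof (induction k)
    case (Suc k)
    have "R ((L ^^ Suc k) S) = op_scale (Q (2 * \<tau>)) (L (R ((L ^^ k) S)))"
      by (simp add: comm qL that)
    also have "\<dots> = op_scale (Q (2 * \<tau>) * Q (2 * \<tau> * int k)) ((L ^^ Suc k) (R S))"
      by (simp add: Suc module_hom.scale[OF lin(1)])
    also have "Q (2 * \<tau>) * Q (2 * \<tau> * int k) = Q (2 * \<tau> * int (Suc k))"
      by (simp only: Q_add[symmetric]) (rule arg_cong[of _ _ Q], simp add: algebra_simps)
    finally show ?case .
  qed simp
  have "((\<lambda>S. L S + R S) ^^ Suc n) T
      = (\<Sum>k\<le>n. op_scale (?g (int k) (int n - int k)) (?X (Suc k)))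
        + (\<Sum>k\<le>n. op_scale (Q (2 * \<tau> * int k) * ?g (int k) (int n - int k)) (?X k))"
  proof -
    have "R ((L ^^ k) ((R ^^ (n - k)) T)) = op_scale (Q (2 * \<tau> * int k)) (?X k)" if "k \<le> n" for k
      using that by (simp add: RL qR Suc_diff_le)
    then have "R (\<Sum>k\<le>n. op_scale (?g (int k) (int n - int k)) ((L ^^ k) ((R ^^ (n - k)) T)))
       = (\<Sum>k\<le>n. op_scale (Q (2 * \<tau> * int k) * ?g (int k) (int n - int k)) (?X k))"
      unfolding module_hom.sum[OF lin(2)] module_hom.scale[OF lin(2)]
      by (intro sum.cong) (simp_all add: mult_ac)
    then show ?thesis
      by (simp add: Suc module_hom.sum[OF lin(1)] module_hom.scale[OF lin(1)])
  qed
  \<comment> \<open>Shifted by one: the new term k = 0 vanishes because \<open>B (-1)\<close> does.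
    In the other sum the term added at \<open>Suc n\<close> vanishes since the second argument of
    \<open>B\<close> is -1.\<close>
  also have "(\<Sum>k\<le>n. op_scale (?g (int k) (int n - int k)) (?X (Suc k)))
      = (\<Sum>k\<le>Suc n. op_scale (?g (int k - 1) (int (Suc n) - int k)) (?X k))"
    unfolding sum.atMost_Suc_shift[of _ n] by simp
  also have "(\<Sum>k\<le>n. op_scale (Q (2 * \<tau> * int k) * ?g (int k) (int n - int k)) (?X k))
      = (\<Sum>k\<le>Suc n. op_scale (Q (2 * \<tau> * int k) * ?g (int k) (int n - int k)) (?X k))"
    by simp
  also have "(\<Sum>k\<le>Suc n. op_scale (?g (int k - 1) (int (Suc n) - int k)) (?X k)) + \<dots>
      = (\<Sum>k\<le>Suc n. op_scale (?g (int k) (int (Suc n) - int k)) (?X k))"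
  proof -
    have step: "?g (int k - 1) (int (Suc n) - int k) + Q (2 * \<tau> * int k) * ?g (int k) (int n - int k)
        = ?g (int k) (int (Suc n) - int k)" if "k \<le> Suc n" for k
    proof -
      define i j where "i = int k" and "j = int (Suc n) - int k"
      have j: "int n - int k = j - 1" by (simp add: j_def)
      have "i \<noteq> 0 \<or> j \<noteq> 0" by (auto simp: i_def j_def)
      \<comment> \<open>The sign of \<tau> decides which of the two q-Pascal rules this is.\<close>
      then have "B i j = Q (- (\<tau> * j)) * B (i - 1) j + Q (\<tau> * i) * B i (j - 1)"
        using \<tau> B_pascal[of i j] by auto
      moreover have "Q (\<tau> * i * j) * Q (- (\<tau> * j)) = Q (\<tau> * (i - 1) * j)"
        by (simp only: Q_add[symmetric]) (rule arg_cong[of _ _ Q], simp add: algebra_simps)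
      moreover have "Q (\<tau> * i * j) * Q (\<tau> * i) = Q (2 * \<tau> * i) * Q (\<tau> * i * (j - 1))"
        by (simp only: Q_add[symmetric]) (rule arg_cong[of _ _ Q], simp add: algebra_simps)
      ultimately have "?g i j = ?g (i - 1) j + Q (2 * \<tau> * i) * ?g i (j - 1)"
        by (simp only: distrib_left mult.assoc[symmetric])
      then show ?thesis
        by (simp only: i_def j j_def[symmetric])
    qed
    show ?thesis
      unfolding sum.distrib[symmetric] qop.scale_left_distrib[symmetric]
      by (intro sum.cong refl) (simp only: step atMost_iff)
  qed
  finally show ?case .
qed

lemma nilpotent_sum:
  fixes L R :: "qop \<Rightarrow> qop"
  assumes "\<tau> = 1 \<or> \<tau> = -1"
    and lin: "oplinear L" "oplinear R"
    and "\<And>S. qlinear S \<Longrightarrow> qlinear (L S)" "\<And>S. qlinear S \<Longrightarrow> qlinear (R S)"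
    and "\<And>S. qlinear S \<Longrightarrow> R (L S) = op_scale (Q (2 * \<tau>)) (L (R S))"
    and T: "qlinear T"
    and nil: "(L ^^ p) T = 0" "(R ^^ p) T = 0"
  shows "((\<lambda>S. L S + R S) ^^ p) T = 0"
proof -
  have "op_scale (Q (\<tau> * int k * (int p - int k)) * B (int k) (int p - int k)) ((L ^^ k) ((R ^^ (p - k)) T)) = 0"
    if "k \<le> p" for k
  proof -
    consider "k = 0" | "0 < k" "k < p" | "k = p" using \<open>k \<le> p\<close> by linarith
    then show ?thesis
    proof cases
      case 1
      then show ?thesis by (simp add: nil qop.scale_zero_right del: zero_fun_apply)
    next
      case 2
      then show ?thesis by (simp add: B_p)
    next
      case 3
      then show ?thesis by (simp add: nil qop.scale_zero_right)
    qed
  qed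
  then have "(\<Sum>k\<le>p. op_scale (Q (\<tau> * int k * (int p - int k)) * B (int k) (int p - int k)) ((L ^^ k) ((R ^^ (p - k)) T))) = 0"
    by (intro sum.neutral) auto
  then show ?thesis
    using q_binomial_theorem[OF assms(1-7), of p] by (rule trans[rotated])
qed

lemma funpow_conj:
  fixes a b :: "'a \<Rightarrow> 'a"
  shows "((\<lambda>S. a \<circ> S \<circ> b) ^^ n) T = (a ^^ n) \<circ> T \<circ> (b ^^ n)"
proof (induction n)
  case (Suc n)
  have "((\<lambda>S. a \<circ> S \<circ> b) ^^ Suc n) T = a \<circ> ((a ^^ n) \<circ> T \<circ> (b ^^ n)) \<circ> b"
    by (simp add: fun_eq_iff Suc)
  also have "\<dots> = (a ^^ Suc n) \<circ> T \<circ> (b ^^ Suc n)"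
    by (simp only: funpow.simps(2)[of n a] funpow_Suc_right[of n b] comp_assoc)
  finally show ?case .
qed simp

lemma oplinear_conj: "qlinear a \<Longrightarrow> oplinear (\<lambda>S. a \<circ> S \<circ> b)"
  by unfold_locales
    (simp_all add: fun_eq_iff op_scale_apply module_hom.add module_hom.scale)

lemma funpow_Ki_E: "Ki ((E ^^ n) u) = qp_scale (Q (-2) ^ n) ((E ^^ n) (Ki u))"
  by (induction n) (simp_all add: Ki_E qlin_scale mult_ac)

lemma funpow_K_F: "K ((F ^^ n) u) = qp_scale (Q (-2) ^ n) ((F ^^ n) (K u))"
  by (induction n) (simp_all add: K_F qlin_scale mult_ac)

text \<open>The scalar collects the powers of q^(-2) from moving each K^(-1) to the right past E;
  its existence is enough to deduce (E K^(-1))^p = 0 from E^p = 0.\<close>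

lemma funpow_E_Ki: "\<exists>c. \<forall>u. ((E \<circ> Ki) ^^ n) u = qp_scale c ((E ^^ n) ((Ki ^^ n) u))"
proof (induction n)
  case 0
  show ?case by (auto intro!: exI[of _ 1])
next
  case (Suc n)
  then obtain c where c: "\<And>u. ((E \<circ> Ki) ^^ n) u = qp_scale c ((E ^^ n) ((Ki ^^ n) u))" by blast
  have "((E \<circ> Ki) ^^ Suc n) u = qp_scale (c * Q (-2) ^ n) ((E ^^ Suc n) ((Ki ^^ Suc n) u))" for u
    by (simp add: c qlin_scale funpow_Ki_E)
  then show ?case by blast
qed

lemma funpow_KF: "\<exists>c. \<forall>u. ((K \<circ> F) ^^ n) u = qp_scale c ((F ^^ n) ((K ^^ n) u))"
proof (induction n)
  case 0
  show ?case by (auto intro!: exI[of _ 1])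
next
  case (Suc n)
  then obtain c where c: "\<And>u. ((K \<circ> F) ^^ n) u = qp_scale c ((F ^^ n) ((K ^^ n) u))" by blast
  have "((K \<circ> F) ^^ Suc n) u = qp_scale (c * Q (-2) * Q (-2) ^ n) ((F ^^ Suc n) ((K ^^ Suc n) u))" for u
    by (simp add: c qlin_scale funpow_K_F K_F mult_ac)
  then show ?case by blast
qed

lemma qlinear_uminus: "qlinear uminus" "qlinear (\<lambda>u. - Ki u)"
  by (unfold_locales; simp add: qlin_add qlin_scale)+

lemma ad_GE_p:
  assumes "qlinear T"
  shows "(ad GE ^^ p) T = 0"
proof -
  \<comment> \<open>The sign goes into the left factor, so that both summands have the form S
    \<mapsto> a S b and iterate by \<open>funpow_conj\<close>; negation is linear, as a left factor
    has to be.\<close>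
  have ad: "ad GE = (\<lambda>S. (E \<circ> S \<circ> Ki) + (uminus \<circ> S \<circ> (E \<circ> Ki)))"
    by (simp add: fun_eq_iff ad_simps)
  show ?thesis
    unfolding ad
  \<comment> \<open>The sign comes from K^(-1) E = q^(-2) E K^(-1), applied to the right of
    \<open>S\<close>.\<close>
  proof (rule nilpotent_sum[where \<tau> = "-1"])
    show "oplinear (\<lambda>S. E \<circ> S \<circ> Ki)" "oplinear (\<lambda>S. uminus \<circ> S \<circ> (E \<circ> Ki))"
      by (intro oplinear_conj qlinear_ops qlinear_uminus)+
    show "qlinear (E \<circ> S \<circ> Ki)" "qlinear (uminus \<circ> S \<circ> (E \<circ> Ki))" if "qlinear S" for S
      by (intro qlinear_compose qlinear_ops qlinear_uminus that)+
    show "uminus \<circ> (E \<circ> S \<circ> Ki) \<circ> (E \<circ> Ki)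
        = op_scale (Q (2 * - 1)) (E \<circ> (uminus \<circ> S \<circ> (E \<circ> Ki)) \<circ> Ki)" if "qlinear S" for S
      by (simp add: fun_eq_iff op_scale_apply Ki_E module_hom.scale[OF that] qlin_scale
          qlinear_ops[THEN module_hom.neg])
    show "((\<lambda>S. E \<circ> S \<circ> Ki) ^^ p) T = 0"
      by (simp only: funpow_conj) (simp add: fun_eq_iff funpow_E_p)
    obtain c where c: "\<And>u. ((E \<circ> Ki) ^^ p) u = qp_scale c ((E ^^ p) ((Ki ^^ p) u))"
      using funpow_E_Ki[of p] by blast
    have "(uminus ^^ p) (T (((E \<circ> Ki) ^^ p) u)) = 0" for u
      by (simp only: c funpow_E_p qp.scale_zero_right module_hom.zero[OF assms]
          module_hom.zero[OF qlinear_funpow[OF qlinear_uminus(1)]])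
    then show "((\<lambda>S. uminus \<circ> S \<circ> (E \<circ> Ki)) ^^ p) T = 0"
      by (simp only: funpow_conj) (simp only: fun_eq_iff comp_apply zero_fun_apply simp_thms)
  qed (use assms in simp_all)
qed

lemma ad_GF_p:
  assumes "qlinear T"
  shows "(ad GF ^^ p) T = 0"
proof -
  have ad: "ad GF = (\<lambda>S. (F \<circ> S \<circ> id) + ((\<lambda>u. - Ki u) \<circ> S \<circ> (K \<circ> F)))"
    by (simp add: fun_eq_iff ad_simps)
  have Ki_F: "Ki (F u) = qp_scale (Q 2) (F (Ki u))" for u
  proof -
    have "F u = K (qp_scale (Q 2) (F (Ki u)))"
      by (simp add: K_F qlin_scale flip: Q_add)
    then show ?thesis by simp
  qed
  show ?thesis
    unfolding ad
  \<comment> \<open>The sign comes from K^(-1) F = q^2 F K^(-1), applied to the left of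
    \<open>S\<close>.\<close>
  proof (rule nilpotent_sum[where \<tau> = 1])
    show "oplinear (\<lambda>S. F \<circ> S \<circ> id)" "oplinear (\<lambda>S. (\<lambda>u. - Ki u) \<circ> S \<circ> (K \<circ> F))"
      by (intro oplinear_conj qlinear_ops qlinear_uminus)+
    show "qlinear (F \<circ> S \<circ> id)" "qlinear ((\<lambda>u. - Ki u) \<circ> S \<circ> (K \<circ> F))" if "qlinear S" for S
      by (simp only: comp_id, intro qlinear_compose qlinear_ops qlinear_uminus that)
        (intro qlinear_compose qlinear_ops qlinear_uminus that)
    show "(\<lambda>u. - Ki u) \<circ> (F \<circ> S \<circ> id) \<circ> (K \<circ> F)
        = op_scale (Q (2 * 1)) (F \<circ> ((\<lambda>u. - Ki u) \<circ> S \<circ> (K \<circ> F)) \<circ> id)" if "qlinear S" for S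
      by (simp add: fun_eq_iff op_scale_apply Ki_F qlin_scale qlinear_ops[THEN module_hom.neg])
    show "((\<lambda>S. F \<circ> S \<circ> id) ^^ p) T = 0"
      by (simp only: funpow_conj) (simp add: fun_eq_iff funpow_F_p)
    obtain c where c: "\<And>u. ((K \<circ> F) ^^ p) u = qp_scale c ((F ^^ p) ((K ^^ p) u))"
      using funpow_KF[of p] by blast
    have "((\<lambda>u. - Ki u) ^^ p) (T (((K \<circ> F) ^^ p) u)) = 0" for u
      by (simp only: c funpow_F_p qp.scale_zero_right module_hom.zero[OF assms]
          module_hom.zero[OF qlinear_funpow[OF qlinear_uminus(2)]])
    then show "((\<lambda>S. (\<lambda>u. - Ki u) \<circ> S \<circ> (K \<circ> F)) ^^ p) T = 0"
      by (simp only: funpow_conj) (simp only: fun_eq_iff comp_apply zero_fun_apply simp_thms)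
  qed (use assms in simp_all)
qed

subsection \<open>The action of the free algebra\<close>

definition word_act :: "gen list \<Rightarrow> qop \<Rightarrow> qop"
  where "word_act w T = foldr ad w T"

definition free_act :: "free \<Rightarrow> qop \<Rightarrow> qop"
  where "free_act f T = pm_sum (\<lambda>w c. op_scale c (word_act w T)) f"

lemma word_act_append: "word_act (v + w) T = word_act v (word_act w T)"
  by (simp add: word_act_def plus_list_def)

lemma word_act_zero: "word_act 0 T = T"
  by (simp add: word_act_def zero_list_def)

lemma word_act_Cons: "word_act (g # w) T = ad g (word_act w T)"
  by (simp add: word_act_def)

lemma oplinear_word_act: "oplinear (word_act w)"
proof (induction w)
  case Nil
  have "word_act [] = (\<lambda>T. T)"
    by (rule ext) (simp only: word_act_def foldr.simps id_apply)
  moreover have "oplinear (\<lambda>T. T)"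
    by unfold_locales (rule refl)+
  ultimately show ?case by (simp only:)
next
  case (Cons g w)
  show ?case
    using module_hom_compose[OF Cons oplinear_ad[of g]] by (simp add: comp_def word_act_Cons)
qed

lemma qlinear_word_act: "qlinear T \<Longrightarrow> qlinear (word_act w T)"
  by (induction w) (simp_all add: word_act_def qlinear_ad)

lemma word_act_in_qdiff_ops: "T \<in> qdiff_ops p \<Longrightarrow> word_act w T \<in> qdiff_ops p"
  by (induction w) (simp_all add: word_act_def ad_in_qdiff_ops)

lemma free_act_add: "free_act (f + g) T = free_act f T + free_act g T"
  unfolding free_act_def by (rule pm_sum_add) (rule qop.scale_left_distrib)

lemma free_act_single: "free_act (Poly_Mapping.single w c) T = op_scale c (word_act w T)"
  unfolding free_act_def by (rule pm_sum_single) (rule qop.scale_zero_left)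

lemma free_act_zero: "free_act 0 T = 0"
  unfolding free_act_def by (rule pm_sum_zero)

lemma free_act_diff: "free_act (f - g) T = free_act f T - free_act g T"
  using free_act_add[of "f - g" g T] by (simp only: diff_add_cancel eq_diff_eq)

lemma oplinear_free_act: "oplinear (free_act f)"
proof (induction f rule: poly_mapping_add_induct)
  case (single w c)
  have "free_act (Poly_Mapping.single w c) = (\<lambda>T. op_scale c (word_act w T))"
    by (rule ext) (rule free_act_single)
  then show ?case by (simp only: qopp.module_hom_scale oplinear_word_act)
next
  case (add f g)
  have "free_act (f + g) = (\<lambda>T. free_act f T + free_act g T)"
    by (rule ext) (rule free_act_add)
  with add show ?case by (simp only: qopp.module_hom_add)
qed

lemma free_act_mult: "free_act (f * g) T = free_act f (free_act g T)"
proof (induction f rule: poly_mapping_add_induct)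
  case (single v c)
  show ?case
  proof (induction g rule: poly_mapping_add_induct)
    case (single w d)
    show ?case
      by (simp only: mult_single free_act_single word_act_append
          module_hom.scale[OF oplinear_word_act] qop.scale_scale)
  next
    case (add f g)
    then show ?case
      by (simp only: distrib_left free_act_add module_hom.add[OF oplinear_free_act])
  qed
qed (simp only: distrib_right free_act_add)

lemma free_act_scalar: "free_act (scalar c) T = op_scale c T"
  by (simp only: scalar_def free_act_single word_act_zero)

lemma free_act_1: "free_act 1 T = T"
  using free_act_scalar[of 1 T] by (simp only: scalar_def single_one qop.scale_one)

lemma free_act_letter: "free_act (letter g) T = ad g T"
  unfolding letter_def free_act_single by (simp only: word_act_def foldr.simps comp_apply id_apply qop.scale_one)

lemma free_act_power: "free_act (f ^ n) T = (free_act f ^^ n) T"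
  by (induction n) (simp_all only: power.simps free_act_1 free_act_mult funpow.simps comp_apply id_apply)

lemma qlinear_free_act:
  assumes "qlinear T"
  shows "qlinear (free_act f T)"
proof (induction f rule: poly_mapping_add_induct)
  case (single w c)
  show ?case unfolding free_act_single by (intro qlinear_op_scale qlinear_word_act assms)
next
  case (add f g)
  then show ?case unfolding free_act_add plus_fun_def by (rule qpp.module_hom_add)
qed

lemma free_act_in_qdiff_ops:
  assumes "T \<in> qdiff_ops p"
  shows "free_act f T \<in> qdiff_ops p"
proof (induction f rule: poly_mapping_add_induct)
  case (single w c)
  show ?case unfolding free_act_single by (intro qdiff_ops_closed word_act_in_qdiff_ops assms)
next
  case (add f g)
  then show ?case unfolding free_act_add by (rule qdiff_ops_closed)
qed

text \<open>\<open>T\<close> has to be linear since the relations move scalars through it, and the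
  p-th powers of E and F to the right of \<open>T\<close> lead to \<open>T 0\<close>.\<close>

lemma free_act_relators:
  assumes "r \<in> relators p" "qlinear T"
  shows "free_act r T = 0"
proof -
  have letter_power: "(free_act (letter g) ^^ n) T = (ad g ^^ n) T" for g n
    by (induction n) (simp_all only: funpow.simps comp_apply free_act_letter)
  have q: "qpar p ^ 2 = Q 2" "inverse (qpar p) ^ 2 = Q (-2)" "qpar p - inverse (qpar p) = Q 1 - Q (-1)"
    by (simp_all add: Q_def power_int_minus power_inverse)
  note simps = free_act_diff free_act_mult free_act_1 free_act_letter free_act_scalar free_act_power
    letter_power ad_GK_GKinv ad_K_conj[OF assms(2)] ad_E_F[OF assms(2)] ad_GE_p[OF assms(2)]
    ad_GF_p[OF assms(2)] ad_K_2p[OF assms(2)] diff_self q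
  from assms(1) show ?thesis
    unfolding relators_def Let_def insert_iff empty_iff
    by (elim disjE; simp only: simps)
qed

end

section \<open>Ideals and cosets\<close>

lemma ring_as_ring: "ring (as_ring :: 'a::ring_1 ring)"
proof (rule ringI)
  show "abelian_group (as_ring :: 'a ring)"
    by (rule abelian_groupI) (auto simp: as_ring_def add_ac intro: exI[of _ "- _"] left_minus)
  show "Group.monoid (as_ring :: 'a ring)"
    by (rule monoidI) (auto simp: as_ring_def mult_ac)
qed (auto simp: as_ring_def distrib_left distrib_right)

lemma ideal_as_ringI:
  fixes I :: "'a::ring_1 set"
  assumes zero: "0 \<in> I" and add: "\<And>x y. x \<in> I \<Longrightarrow> y \<in> I \<Longrightarrow> x + y \<in> I"
    and left: "\<And>a x. x \<in> I \<Longrightarrow> a * x \<in> I" and right: "\<And>a x. x \<in> I \<Longrightarrow> x * a \<in> I"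
  shows "ideal I as_ring"
proof (rule idealI[OF ring_as_ring])
  interpret ring "as_ring :: 'a ring" by (rule ring_as_ring)
  have inv: "inv\<^bsub>add_monoid as_ring\<^esub> x = - x" for x :: 'a
    using minus_equality[of "- x" x] by (simp add: as_ring_def a_inv_def)
  have "- x \<in> I" if "x \<in> I" for x
    using left[OF that, of "- 1"] by simp
  then show "subgroup I (add_monoid as_ring)"
    unfolding subgroup_def inv by (auto simp: as_ring_def zero add)
qed (auto simp: as_ring_def left right)

lemma Idl_as_ring_ideal: "ideal (Idl\<^bsub>as_ring\<^esub> S) (as_ring :: 'a::ring_1 ring)"
  by (rule ring.genideal_ideal[OF ring_as_ring]) (simp add: as_ring_def)

lemma Idl_as_ring_subset:
  fixes I :: "'a::ring_1 set"
  shows "ideal I as_ring \<Longrightarrow> S \<subseteq> I \<Longrightarrow> Idl\<^bsub>as_ring\<^esub> S \<subseteq> I"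
  by (rule ring.genideal_minimal[OF ring_as_ring])

lemma mem_coset_as_ring: "g \<in> I +>\<^bsub>as_ring\<^esub> f \<longleftrightarrow> g - f \<in> I"
  by (force simp: a_r_coset_def' as_ring_def)

lemma carrier_U: "carrier (U p) = range (U_class p)"
  by (auto simp: U_def FactRing_def A_RCOSETS_def' U_class_def as_ring_def)

lemma U_class_in_carrier: "U_class p f \<in> carrier (U p)"
  by (simp add: carrier_U)

lemma ideal_U_ideal: "ideal (U_ideal p) as_ring"
  unfolding U_ideal_def by (rule Idl_as_ring_ideal)

lemma U_class_mult: "U_class p f \<otimes>\<^bsub>U p\<^esub> U_class p g = U_class p (f * g)"
  using ring_hom_mult[OF ideal.rcos_ring_hom[OF ideal_U_ideal], of f g]
  by (simp add: U_def U_class_def as_ring_def)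

lemma U_class_add: "U_class p f \<oplus>\<^bsub>U p\<^esub> U_class p g = U_class p (f + g)"
  using ring_hom_add[OF ideal.rcos_ring_hom[OF ideal_U_ideal], of f g]
  by (simp add: U_def U_class_def as_ring_def)

lemma mem_U_class: "g \<in> U_class p f \<longleftrightarrow> g - f \<in> U_ideal p"
  unfolding U_class_def by (rule mem_coset_as_ring)

lemma U_class_self: "f \<in> U_class p f"
  using additive_subgroup.zero_closed[OF ideal.axioms(1)[OF ideal_U_ideal[of p]]]
  by (simp add: mem_U_class as_ring_def)

lemma relator_in_U_ideal: "r \<in> relators p \<Longrightarrow> r \<in> U_ideal p"
  using ring.genideal_self[OF ring_as_ring, of "relators p"]
  by (auto simp: U_ideal_def as_ring_def)

lemma U_class_cong:
  assumes "f - g \<in> U_ideal p"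
  shows "U_class p f = U_class p g"
proof -
  interpret ideal "U_ideal p" as_ring by (rule ideal_U_ideal)
  from assms have "f \<in> U_ideal p +>\<^bsub>as_ring\<^esub> g"
    by (simp add: mem_coset_as_ring)
  from a_repr_independence[OF this _ a_subgroup] show ?thesis
    by (simp add: U_class_def as_ring_def)
qed

lemma U_class_K_Kinv:
  "U_class p (fK * fKinv) = U_class p 1" "U_class p (fKinv * fK) = U_class p 1"
  by (intro U_class_cong relator_in_U_ideal; simp add: relators_def Let_def)+

section \<open>The coproduct on generators\<close>

lemma tensor_conv:
  "tensor f g = pm_sum (\<lambda>v c. pm_sum (\<lambda>w d. Poly_Mapping.single (v, w) (c * d)) g) f"
  by (simp add: tensor_def pm_sum_def)

lemma tensor_single:
  "tensor (Poly_Mapping.single v c) (Poly_Mapping.single w d) = Poly_Mapping.single (v, w) (c * d)"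
  by (simp add: tensor_conv pm_sum_single)

lemma tensor_add_left: "tensor (f + g) h = tensor f h + tensor g h"
  unfolding tensor_conv
  by (rule pm_sum_add) (simp add: pm_sum_def distrib_right single_add sum.distrib)

lemma tensor_add_right: "tensor f (g + h) = tensor f g + tensor f h"
proof -
  have "pm_sum (\<lambda>w d. Poly_Mapping.single (v, w) (c * d)) (g + h)
      = pm_sum (\<lambda>w d. Poly_Mapping.single (v, w) (c * d)) g
        + pm_sum (\<lambda>w d. Poly_Mapping.single (v, w) (c * d)) h" for v :: "gen list" and c :: complex
    by (rule pm_sum_add) (simp add: distrib_left single_add)
  then show ?thesis
    unfolding tensor_conv by (simp add: pm_sum_def sum.distrib)
qed

text \<open>Written in basis vectors rather than by \<open>tensor\<close>, so that
  \<open>pair_act_single\<close> evaluates it; the proof of \<open>free_comult_conv\<close>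
  identifies the two forms.\<close>

definition gen_comult :: "gen \<Rightarrow> free2"
  where "gen_comult g = (case g of
      GE \<Rightarrow> Poly_Mapping.single ([GE], [GK]) 1 + Poly_Mapping.single ([], [GE]) 1
    | GF \<Rightarrow> Poly_Mapping.single ([GF], []) 1 + Poly_Mapping.single ([GKinv], [GF]) 1
    | GK \<Rightarrow> Poly_Mapping.single ([GK], [GK]) 1
    | GKinv \<Rightarrow> Poly_Mapping.single ([GKinv], [GKinv]) 1)"

lemma one_conv_single: "(1 :: free) = Poly_Mapping.single [] 1"
  by (simp flip: single_one add: zero_list_def)

lemma free_comult_conv:
  "free_comult f = pm_sum (\<lambda>w c. scalar c * prod_list (map gen_comult w)) f"
proof -
  have "(\<lambda>g. case g of
      GE \<Rightarrow> tensor fE fK + tensor 1 fE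
    | GF \<Rightarrow> tensor fF 1 + tensor fKinv fF
    | GK \<Rightarrow> tensor fK fK
    | GKinv \<Rightarrow> tensor fKinv fKinv) = gen_comult"
    by (rule ext) (simp add: gen_comult_def letter_def tensor_single one_conv_single split: gen.split)
  then show ?thesis
    by (simp add: free_comult_def free_extend_def pm_sum_def)
qed

lemma scalar_add: "scalar (c + d) = scalar c + scalar d"
  by (simp add: scalar_def single_add)

lemma scalar_zero: "scalar 0 = 0"
  by (simp add: scalar_def)

lemma scalar_one: "scalar 1 = 1"
  by (simp add: scalar_def)

lemma free_comult_add: "free_comult (f + g) = free_comult f + free_comult g"
  unfolding free_comult_conv by (rule pm_sum_add) (simp add: scalar_add distrib_right)

lemma free_comult_single:
  "free_comult (Poly_Mapping.single w c) = scalar c * prod_list (map gen_comult w)"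
  unfolding free_comult_conv by (rule pm_sum_single) (simp add: scalar_zero)

lemma free_comult_letter: "free_comult (letter g) = gen_comult g"
  by (simp add: letter_def free_comult_single scalar_one)

lemma free_counit_conv:
  "free_counit f = pm_sum (\<lambda>w c. c * prod_list (map (\<lambda>g. case g of GE \<Rightarrow> 0 | GF \<Rightarrow> 0 | GK \<Rightarrow> 1 | GKinv \<Rightarrow> 1) w)) f"
  by (simp add: free_counit_def free_extend_def pm_sum_def)

lemma free_counit_add: "free_counit (f + g) = free_counit f + free_counit g"
  unfolding free_counit_conv by (rule pm_sum_add) (simp add: distrib_right)

lemma free_counit_single:
  "free_counit (Poly_Mapping.single w c) = c * prod_list (map (\<lambda>g. case g of GE \<Rightarrow> 0 | GF \<Rightarrow> 0 | GK \<Rightarrow> 1 | GKinv \<Rightarrow> 1) w)"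
  unfolding free_counit_conv by (rule pm_sum_single) simp

section \<open>Consequences of the module algebra axioms\<close>

context U_module_algebra
begin

text \<open>Lets \<open>act_mult\<close> be instantiated with the coproduct of a representative; the
  coset contains it because the ideal contains 0.\<close>

lemma free_comult_in_comult: "free_comult f \<in> comult p (U_class p f)"
proof -
  have "ideal (UU_ideal p) as_ring"
    unfolding UU_ideal_def by (rule Idl_as_ring_ideal)
  then have "0 \<in> UU_ideal p"
    using additive_subgroup.zero_closed[OF ideal.axioms(1)] by (fastforce simp: as_ring_def)
  then have "free_comult f \<in> UU_ideal p +>\<^bsub>as_ring\<^esub> free_comult f"
    by (simp add: mem_coset_as_ring)
  then show ?thesis
    unfolding comult_def using U_class_self by blast
qed

lemma act_empty_word: "u \<in> M \<Longrightarrow> act (U_class p (Poly_Mapping.single [] 1)) u = u"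
  using act_scalar[of u 1] by (simp add: scalar_def zero_list_def)

text \<open>Obtained by evaluating \<open>act_mult\<close> at the coproducts of the four letters;
  the empty word occurring in them acts as the identity by \<open>act_scalar\<close>.\<close>

lemma act_letter_mult:
  assumes "u \<in> M" "v \<in> M"
  shows "act (U_class p fE) (mul u v) = mul (act (U_class p fE) u) (act (U_class p fK) v) + mul u (act (U_class p fE) v)"
    and "act (U_class p fF) (mul u v) = mul (act (U_class p fF) u) v + mul (act (U_class p fKinv) u) (act (U_class p fF) v)"
    and "act (U_class p fK) (mul u v) = mul (act (U_class p fK) u) (act (U_class p fK) v)"
    and "act (U_class p fKinv) (mul u v) = mul (act (U_class p fKinv) u) (act (U_class p fKinv) v)"
proof -
  define h where "h = (\<lambda>(a, b) c. scale c (mul (act (U_class p (Poly_Mapping.single a 1)) u)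
                     (act (U_class p (Poly_Mapping.single b 1)) v)))"
  have "act (U_class p (letter g)) (mul u v) = pm_sum h (gen_comult g)" for g
    using act_mult[OF U_class_in_carrier free_comult_in_comult assms, of "letter g"]
    by (simp add: free_comult_letter pm_sum_def h_def case_prod_beta)
  moreover have "pm_sum h (s + t) = pm_sum h s + pm_sum h t" for s t
    by (rule pm_sum_add) (auto simp: h_def scale_left_distrib)
  moreover have "pm_sum h (Poly_Mapping.single (a, b) 1)
      = mul (act (U_class p (Poly_Mapping.single a 1)) u) (act (U_class p (Poly_Mapping.single b 1)) v)" for a b
    by (subst pm_sum_single) (simp_all add: h_def case_prod_beta)
  ultimately show "act (U_class p fE) (mul u v) = mul (act (U_class p fE) u) (act (U_class p fK) v) + mul u (act (U_class p fE) v)"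
    and "act (U_class p fF) (mul u v) = mul (act (U_class p fF) u) v + mul (act (U_class p fKinv) u) (act (U_class p fF) v)"
    and "act (U_class p fK) (mul u v) = mul (act (U_class p fK) u) (act (U_class p fK) v)"
    and "act (U_class p fKinv) (mul u v) = mul (act (U_class p fKinv) u) (act (U_class p fKinv) v)"
    by (simp_all add: gen_comult_def act_empty_word assms letter_def)
qed

lemma act_class_mult: "u \<in> M \<Longrightarrow> act (U_class p (f * g)) u = act (U_class p f) (act (U_class p g) u)"
  using act_times[OF U_class_in_carrier U_class_in_carrier] by (simp add: U_class_mult)

lemma act_class_add: "u \<in> M \<Longrightarrow> act (U_class p (f + g)) u = act (U_class p f) u + act (U_class p g) u"
  using act_add_left[OF U_class_in_carrier U_class_in_carrier] by (simp add: U_class_add)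

lemma act_K_Kinv:
  "u \<in> M \<Longrightarrow> act (U_class p fK) (act (U_class p fKinv) u) = u"
  "u \<in> M \<Longrightarrow> act (U_class p fKinv) (act (U_class p fK) u) = u"
  using act_scalar[of u 1] by (simp_all add: U_class_K_Kinv scalar_one flip: act_class_mult)

lemma act_zero_right: "h \<in> carrier (U p) \<Longrightarrow> act h 0 = 0"
  using act_scale_right[OF _ unit_closed, of h 0] by simp

end

section \<open>The action of $U$\<close>

context root_param
begin

text \<open>Linear arguments are demanded because composition is additive and homogeneous in its
  second argument once the first is linear.\<close>

definition bilinear_op :: "(qop \<Rightarrow> qop \<Rightarrow> qop) \<Rightarrow> bool"
  where "bilinear_op \<beta> \<longleftrightarrow> (\<forall>u v w. qlinear u \<and> qlinear v \<and> qlinear w \<longrightarrow>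
    \<beta> (u + v) w = \<beta> u w + \<beta> v w \<and> \<beta> w (u + v) = \<beta> w u + \<beta> w v \<and>
    (\<forall>c. \<beta> (op_scale c u) v = op_scale c (\<beta> u v) \<and> \<beta> u (op_scale c v) = op_scale c (\<beta> u v)))"

lemma bilinear_opD:
  assumes "bilinear_op \<beta>"
  shows "qlinear u \<Longrightarrow> qlinear v \<Longrightarrow> qlinear w \<Longrightarrow> \<beta> (u + v) w = \<beta> u w + \<beta> v w"
    and "qlinear u \<Longrightarrow> qlinear v \<Longrightarrow> qlinear w \<Longrightarrow> \<beta> w (u + v) = \<beta> w u + \<beta> w v"
    and "qlinear u \<Longrightarrow> qlinear v \<Longrightarrow> \<beta> (op_scale c u) v = op_scale c (\<beta> u v)"
    and "qlinear u \<Longrightarrow> qlinear v \<Longrightarrow> \<beta> u (op_scale c v) = op_scale c (\<beta> u v)"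
  using assms unfolding bilinear_op_def by blast+

lemma bilinear_op_zero:
  assumes "bilinear_op \<beta>" "qlinear u"
  shows "\<beta> 0 u = 0" "\<beta> u 0 = 0"
  using bilinear_opD(3)[OF assms(1) qlinear_0 assms(2), of 0] bilinear_opD(4)[OF assms(1) assms(2) qlinear_0, of 0]
  by (simp_all only: qop.scale_zero_left)

text \<open>Replaces an action on the tensor product of the operator space with itself: letting
  \<beta> range over all bilinear maps takes the place of the universal property.\<close>

definition pair_act :: "(qop \<Rightarrow> qop \<Rightarrow> qop) \<Rightarrow> free2 \<Rightarrow> qop \<Rightarrow> qop \<Rightarrow> qop"
  where "pair_act \<beta> t u v = pm_sum (\<lambda>(a, b) c. op_scale c (\<beta> (word_act a u) (word_act b v))) t"

lemma pair_act_add: "pair_act \<beta> (s + t) u v = pair_act \<beta> s u v + pair_act \<beta> t u v"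
  unfolding pair_act_def by (rule pm_sum_add) (simp only: case_prod_beta qop.scale_left_distrib)

lemma pair_act_single:
  "pair_act \<beta> (Poly_Mapping.single (a, b) c) u v = op_scale c (\<beta> (word_act a u) (word_act b v))"
  unfolding pair_act_def by (subst pm_sum_single) (simp_all only: case_prod_conv case_prod_beta fst_conv snd_conv qop.scale_zero_left)

lemma pair_act_zero: "pair_act \<beta> 0 u v = 0"
  unfolding pair_act_def by (rule pm_sum_zero)

text \<open>In a product the left factor acts last and can be absorbed into \<beta>; the right
  factor acts first and changes \<open>u\<close> and \<open>v\<close>.\<close>

lemma pair_act_mult_single_left:
  "pair_act \<beta> (Poly_Mapping.single (a, b) c * t) u v
    = op_scale c (pair_act (\<lambda>u v. \<beta> (word_act a u) (word_act b v)) t u v)"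
proof (induction t rule: poly_mapping_add_induct)
  case (single k d)
  show ?case
    by (cases k) (simp only: mult_single plus_prod_def fst_conv snd_conv pair_act_single word_act_append qop.scale_scale)
qed (simp only: distrib_left pair_act_add qop.scale_right_distrib)

lemma pair_act_mult_single_right:
  "pair_act \<beta> (t * Poly_Mapping.single (a, b) c) u v
    = op_scale c (pair_act \<beta> t (word_act a u) (word_act b v))"
proof (induction t rule: poly_mapping_add_induct)
  case (single k d)
  show ?case
    by (cases k) (simp only: mult_single plus_prod_def fst_conv snd_conv pair_act_single word_act_append
        qop.scale_scale mult.commute[of d c])
qed (simp only: distrib_right pair_act_add qop.scale_right_distrib)

lemma bilinear_op_word_act:
  "bilinear_op \<beta> \<Longrightarrow> bilinear_op (\<lambda>u v. \<beta> (word_act a u) (word_act b v))"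
  unfolding bilinear_op_def
  by (simp only: module_hom.add[OF oplinear_word_act] module_hom.scale[OF oplinear_word_act]
      qlinear_word_act simp_thms)
    (meson qlinear_word_act)

text \<open>Quantifying over all bilinear \<open>\<beta>\<close> makes \<open>pair_kernel\<close> a left ideal; for \<open>\<beta> = (\<circ>)\<close> alone
  this is not clear.\<close>

definition pair_kernel :: "free2 set"
  where "pair_kernel = {t. \<forall>\<beta> u v. bilinear_op \<beta> \<longrightarrow> qlinear u \<longrightarrow> qlinear v \<longrightarrow> pair_act \<beta> t u v = 0}"

lemma ideal_pair_kernel: "ideal pair_kernel as_ring"
proof (rule ideal_as_ringI)
  show "0 \<in> pair_kernel" by (simp only: pair_kernel_def mem_Collect_eq pair_act_zero simp_thms)
  show "x + y \<in> pair_kernel" if "x \<in> pair_kernel" "y \<in> pair_kernel" for x y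
    using that by (auto simp only: pair_kernel_def mem_Collect_eq pair_act_add add_0_left)
  then have add: "x \<in> pair_kernel \<Longrightarrow> y \<in> pair_kernel \<Longrightarrow> x + y \<in> pair_kernel" for x y .
  show "a * x \<in> pair_kernel" if x: "x \<in> pair_kernel" for a x
  proof (induction a rule: poly_mapping_add_induct)
    case (single k c)
    obtain v w where k: "k = (v, w)" by (cases k)
    \<comment> \<open>Left multiplication replaces \<beta> by another bilinear map, for which
      \<open>x\<close> still gives zero.\<close>
    have "pair_act (\<lambda>u u'. \<beta> (word_act v u) (word_act w u')) x u u' = 0"
      if "bilinear_op \<beta>" "qlinear u" "qlinear u'" for \<beta> u u'
      using x bilinear_op_word_act[OF that(1)] that(2,3) unfolding pair_kernel_def by blast
    then show ?case
      by (auto simp only: pair_kernel_def mem_Collect_eq k pair_act_mult_single_left qop.scale_zero_right)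
  qed (simp only: distrib_right add)
  show "x * a \<in> pair_kernel" if x: "x \<in> pair_kernel" for a x
  proof (induction a rule: poly_mapping_add_induct)
    case (single k c)
    obtain v w where k: "k = (v, w)" by (cases k)
    show ?case
      using x qlinear_word_act
      by (auto simp only: pair_kernel_def mem_Collect_eq k pair_act_mult_single_right qop.scale_zero_right)
  qed (simp only: distrib_left add)
qed

lemma pair_act_tensor_1:
  assumes "bilinear_op \<beta>" "qlinear u" "qlinear v"
  shows "pair_act \<beta> (tensor f 1) u v = \<beta> (free_act f u) v"
    and "pair_act \<beta> (tensor 1 f) u v = \<beta> u (free_act f v)"
proof -
  note lin = assms(2,3) qlinear_free_act qlinear_word_act
  note word_Nil = word_act_zero[unfolded zero_list_def]
  show "pair_act \<beta> (tensor f 1) u v = \<beta> (free_act f u) v"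
  proof (induction f rule: poly_mapping_add_induct)
    case (single w c)
    show ?case
      by (simp only: one_conv_single tensor_single mult_1_right pair_act_single word_Nil free_act_single
          bilinear_opD(3)[OF assms(1)] lin)
  next
    case (add f g)
    then show ?case
      by (simp only: tensor_add_left pair_act_add free_act_add bilinear_opD(1)[OF assms(1)] lin)
  qed
  show "pair_act \<beta> (tensor 1 f) u v = \<beta> u (free_act f v)"
  proof (induction f rule: poly_mapping_add_induct)
    case (single w c)
    show ?case
      by (simp only: one_conv_single tensor_single mult_1_left pair_act_single word_Nil free_act_single
          bilinear_opD(4)[OF assms(1)] lin)
  next
    case (add f g)
    then show ?case
      by (simp only: tensor_add_right pair_act_add free_act_add bilinear_opD(2)[OF assms(1)] lin)
  qed
qed

text \<open>A relator in either slot annihilates one argument of \<beta>, so the generators of the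
  ideal lie in the kernel. Hence Sweedler sums depend only on the coset of the coproduct.\<close>

lemma UU_ideal_subset: "UU_ideal p \<subseteq> pair_kernel"
  unfolding UU_ideal_def
proof (rule Idl_as_ring_subset[OF ideal_pair_kernel])
  show "(\<lambda>r. tensor r 1) ` relators p \<union> (\<lambda>r. tensor 1 r) ` relators p \<subseteq> pair_kernel"
    by (auto simp only: pair_kernel_def pair_act_tensor_1 free_act_relators bilinear_op_zero)
qed

text \<open>Annihilating all linear operators, rather than one, makes the set of such elements
  two-sided: after right multiplication by g the argument is \<open>free_act g T\<close>, again
  linear.\<close>

lemma U_ideal_kernel:
  assumes "f \<in> U_ideal p" "qlinear T"
  shows "free_act f T = 0"
proof -
  let ?I = "{f. \<forall>T. qlinear T \<longrightarrow> free_act f T = 0}"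
  have "ideal ?I as_ring"
    by (rule ideal_as_ringI)
      (auto simp only: mem_Collect_eq free_act_zero free_act_add free_act_mult qlinear_free_act
        module_hom.zero[OF oplinear_free_act] add_0_left)
  then have "U_ideal p \<subseteq> ?I"
    unfolding U_ideal_def by (rule Idl_as_ring_subset) (auto simp only: free_act_relators)
  with assms show ?thesis by blast
qed

lemma bilinear_op_comp: "bilinear_op (\<circ>)"
  unfolding bilinear_op_def
  by (auto simp: fun_eq_iff op_scale_apply module_hom.add module_hom.scale)

lemma pair_act_gen_comult:
  assumes "qlinear S"
  shows "pair_act (\<circ>) (gen_comult g) S T = ad g (S \<circ> T)"
proof -
  note word = word_act_Cons word_act_zero[unfolded zero_list_def]
  show ?thesis
    by (cases g; simp only: gen_comult_def gen.case pair_act_add pair_act_single word qop.scale_one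
        ad_comp[OF assms])
qed

text \<open>The product of the coproducts of the letters matches the iterated Leibniz rule. The head
  letter acts last, hence stands on the left; expanding the remaining coproduct into basis vectors
  reduces the step to \<open>pair_act_gen_comult\<close>.\<close>

lemma word_act_comp:
  assumes "qlinear S" "qlinear T"
  shows "word_act w (S \<circ> T) = pair_act (\<circ>) (prod_list (map gen_comult w)) S T"
proof (induction w)
  case Nil
  have 1: "(1 :: free2) = Poly_Mapping.single ([], []) 1"
    by (simp flip: single_one add: zero_prod_def zero_list_def)
  have "pair_act (\<circ>) 1 S T = S \<circ> T"
    unfolding 1 by (simp only: pair_act_single word_act_zero[unfolded zero_list_def] qop.scale_one)
  then show ?case
    by (simp only: list.map prod_list.Nil word_act_zero[unfolded zero_list_def])
next
  case (Cons g w)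
  have "ad g (pair_act (\<circ>) t S T) = pair_act (\<circ>) (gen_comult g * t) S T" for t
  proof (induction t rule: poly_mapping_add_induct)
    case (single k c)
    show ?case
      by (cases k) (simp only: pair_act_single pair_act_mult_single_right module_hom.scale[OF oplinear_ad]
          pair_act_gen_comult qlinear_word_act assms)
  qed (simp only: distrib_left pair_act_add module_hom.add[OF oplinear_ad])
  then show ?case
    by (simp only: word_act_Cons Cons list.map prod_list.Cons)
qed

lemma free_act_comp:
  assumes "qlinear S" "qlinear T"
  shows "free_act f (S \<circ> T) = pair_act (\<circ>) (free_comult f) S T"
proof (induction f rule: poly_mapping_add_induct)
  case (single w c)
  have "scalar c = Poly_Mapping.single (0 :: gen list, 0 :: gen list) c"
    by (simp add: scalar_def zero_prod_def)
  then show ?case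
    by (simp only: free_act_single free_comult_single pair_act_mult_single_left word_act_zero word_act_comp assms)
qed (simp only: free_act_add free_comult_add pair_act_add)

lemma free_act_id: "free_act f id = op_scale (free_counit f) id"
proof (induction f rule: poly_mapping_add_induct)
  case (single w c)
  have "word_act w id = op_scale (prod_list (map (\<lambda>g. case g of GE \<Rightarrow> 0 | GF \<Rightarrow> 0 | GK \<Rightarrow> 1 | GKinv \<Rightarrow> 1) w)) id"
  proof (induction w)
    case (Cons g w)
    show ?case
      by (cases g; simp only: word_act_Cons Cons module_hom.scale[OF oplinear_ad] ad_id list.map
          prod_list.Cons gen.case mult_zero_left mult_1_left qop.scale_zero_left qop.scale_zero_right)
  qed (simp only: word_act_zero[unfolded zero_list_def] list.map prod_list.Nil qop.scale_one)
  then show ?case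
    by (simp only: free_act_single free_counit_single qop.scale_scale)
qed (simp only: free_act_add free_counit_add qop.scale_left_distrib)

text \<open>By \<open>free_act_cong\<close> the chosen representative does not influence the result
  on linear operators, which include all of \<open>qdiff_ops p\<close>.\<close>

definition U_act :: "free set \<Rightarrow> qop \<Rightarrow> qop"
  where "U_act h = free_act (SOME f. f \<in> h)"

lemma free_act_cong:
  assumes "f \<in> U_class p g" "qlinear T"
  shows "free_act f T = free_act g T"
  using U_ideal_kernel[of "f - g" T] assms by (simp only: mem_U_class free_act_diff right_minus_eq)

lemma U_act_class: "qlinear T \<Longrightarrow> U_act (U_class p f) T = free_act f T"
  unfolding U_act_def by (rule free_act_cong[OF someI[of "\<lambda>g. g \<in> U_class p f", OF U_class_self]])

lemma U_module_algebra_U_act: "U_module_algebra op_scale p (qdiff_ops p) (\<circ>) id U_act"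
proof (intro U_module_algebra.intro U_module_algebra_axioms.intro)
  note lin = qlinear_qdiff_ops
  show "vector_space op_scale" by (rule qop.vector_space_axioms)
  show "qop.subspace (qdiff_ops p)" unfolding qdiff_ops_def by (rule qop.subspace_span)
  fix u v w :: qop and c :: complex and g h t
  assume u: "u \<in> qdiff_ops p"
  show "(u \<circ> v) \<circ> w = u \<circ> (v \<circ> w)" by (rule comp_assoc)
  show "u \<circ> v \<in> qdiff_ops p" if "v \<in> qdiff_ops p"
    using u that by (rule comp_in_qdiff_ops)
  show "(u + v) \<circ> w = (u \<circ> w) + (v \<circ> w)" "op_scale c u \<circ> v = op_scale c (u \<circ> v)"
    by (simp_all add: fun_eq_iff op_scale_apply)
  show "u \<circ> (v + w) = (u \<circ> v) + (u \<circ> w)" "u \<circ> op_scale c v = op_scale c (u \<circ> v)"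
    by (simp_all add: fun_eq_iff op_scale_apply module_hom.add[OF lin[OF u]] module_hom.scale[OF lin[OF u]])
  show "U_act (U_class p (scalar c)) u = op_scale c u"
    by (simp only: U_act_class lin[OF u] free_act_scalar)
  assume "h \<in> carrier (U p)"
  then obtain f where h: "h = U_class p f" by (auto simp: carrier_U)
  show "U_act h u \<in> qdiff_ops p"
    by (simp only: h U_act_class lin u free_act_in_qdiff_ops)
  show "U_act h (op_scale c u) = op_scale c (U_act h u)"
    by (simp only: h U_act_class lin u qlinear_op_scale module_hom.scale[OF oplinear_free_act])
  show "U_act h (u + v) = U_act h u + U_act h v" if v: "v \<in> qdiff_ops p"
    by (simp only: h U_act_class lin u v qdiff_ops_closed module_hom.add[OF oplinear_free_act])
  show "U_act h (u \<circ> v) = (\<Sum>(a, b)\<in>Poly_Mapping.keys t. op_scale (Poly_Mapping.lookup t (a, b))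
           (U_act (U_class p (Poly_Mapping.single a 1)) u \<circ> U_act (U_class p (Poly_Mapping.single b 1)) v))"
    if t: "t \<in> comult p h" and v: "v \<in> qdiff_ops p"
  proof -
    \<comment> \<open>Two choices enter: the representative f' of h, and the representative t of the
      coset of its coproduct. \<open>UU_ideal_subset\<close> disposes of the second,
      \<open>free_act_cong\<close> of the first.\<close>
    from t obtain f' where f': "f' \<in> U_class p f" "t - free_comult f' \<in> UU_ideal p"
      unfolding comult_def h by (auto simp: mem_coset_as_ring)
    have "pair_act (\<circ>) (t - free_comult f') u v = 0"
      using UU_ideal_subset f'(2) bilinear_op_comp lin[OF u] lin[OF v] unfolding pair_kernel_def by blast
    then have "pair_act (\<circ>) t u v = pair_act (\<circ>) (free_comult f') u v"
      using pair_act_add[of "(\<circ>)" "t - free_comult f'" "free_comult f'" u v]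
      by (simp only: diff_add_cancel add_0_left)
    also have "\<dots> = U_act h (u \<circ> v)"
      by (simp only: h free_act_comp[OF lin[OF u] lin[OF v], symmetric] U_act_class
          lin[OF comp_in_qdiff_ops[OF u v]] free_act_cong[OF f'(1)])
    finally show ?thesis
      unfolding pair_act_def pm_sum_def U_act_class[OF lin[OF u]] U_act_class[OF lin[OF v]]
        free_act_single qop.scale_one case_prod_unfold prod.collapse by (rule sym)
  qed
  assume "g \<in> carrier (U p)"
  then obtain f' where g: "g = U_class p f'" by (auto simp: carrier_U)
  show "U_act (g \<oplus>\<^bsub>U p\<^esub> h) u = U_act g u + U_act h u"
    by (simp only: g h U_class_add U_act_class lin u free_act_add)
  show "U_act (g \<otimes>\<^bsub>U p\<^esub> h) u = U_act g (U_act h u)"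
    by (simp only: g h U_class_mult U_act_class lin u free_act_mult free_act_in_qdiff_ops)
next
  fix h f assume "h \<in> carrier (U p)" and f: "f \<in> h"
  then obtain g where h: "h = U_class p g" by (auto simp: carrier_U)
  show "U_act h id = op_scale (free_counit f) id"
    using free_act_cong[OF f[unfolded h] qlinear_qdiff_ops[OF id_in_qdiff_ops]]
    by (simp only: h U_act_class qlinear_qdiff_ops[OF id_in_qdiff_ops] free_act_id)
qed (simp_all add: id_in_qdiff_ops)

lemma prescribed_action_U_act: "prescribed_action p U_act"
  unfolding prescribed_action_def
  by (simp only: U_act_class qlinear_ops qlinear_qp_mult free_act_letter ad_mult ad_dx ad_dy simp_thms)

text \<open>The action of K^(-1) is not prescribed but forced as the inverse of K. The order K,
  K^(-1), E, F follows the coproducts: on composites E needs K, and F needs K^(-1).\<close>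

lemma U_action_unique:
  assumes 1: "U_module_algebra op_scale p (qdiff_ops p) (\<circ>) id act\<^sub>1" and P1: "prescribed_action p act\<^sub>1"
    and 2: "U_module_algebra op_scale p (qdiff_ops p) (\<circ>) id act\<^sub>2" and P2: "prescribed_action p act\<^sub>2"
    and h: "h \<in> carrier (U p)" and T: "T \<in> qdiff_ops p"
  shows "act\<^sub>1 h T = act\<^sub>2 h T"
proof -
  interpret A: U_module_algebra op_scale p "qdiff_ops p" "(\<circ>)" id act\<^sub>1 by (rule 1)
  interpret B: U_module_algebra op_scale p "qdiff_ops p" "(\<circ>)" id act\<^sub>2 by (rule 2)
  let ?eq = "\<lambda>g T. act\<^sub>1 (U_class p (letter g)) T = act\<^sub>2 (U_class p (letter g)) T"
  note P = P1[unfolded prescribed_action_def] P2[unfolded prescribed_action_def]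
  note carr = U_class_in_carrier
  \<comment> \<open>All cases but composition are common to K, E and F; composition is left as a
    premise because it uses agreement for other letters. \<open>GKinv\<close> is excluded since
    \<open>prescribed_action\<close> gives it no values on the generators.\<close>
  have induct: "?eq g T"
    if "T \<in> qdiff_ops p" and "g \<noteq> GKinv"
      and "\<And>S T. S \<in> qdiff_ops p \<Longrightarrow> T \<in> qdiff_ops p \<Longrightarrow> ?eq g S \<Longrightarrow> ?eq g T \<Longrightarrow> ?eq g (S \<circ> T)" for g T
    using that(1)
  proof (induction rule: qdiff_ops_induct)
    case zero
    show ?case by (simp only: A.act_zero_right B.act_zero_right carr)
  next
    case (add S T)
    then show ?case by (simp only: A.act_add_right B.act_add_right carr)
  next
    case (scale c T)
    then show ?case by (simp only: A.act_scale_right B.act_scale_right carr)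
  next
    case (comp S T)
    then show ?case by (rule that(3))
  qed (use that(2) P in \<open>cases g; simp only: simp_thms; fail\<close>)+
  have K: "?eq GK T" if "T \<in> qdiff_ops p" for T
    using that by (rule induct) (simp_all only: A.act_letter_mult B.act_letter_mult gen.distinct not_False_eq_True)
  have Kinv: "?eq GKinv T" if "T \<in> qdiff_ops p" for T
  proof -
    \<comment> \<open>Agreement for K at K^(-1) T, formed with the second action, transfers to
      K^(-1) at T.\<close>
    let ?S = "act\<^sub>2 (U_class p fKinv) T"
    have S: "?S \<in> qdiff_ops p" using that by (rule B.act_closed[OF carr])
    have "act\<^sub>1 (U_class p fKinv) T = act\<^sub>1 (U_class p fKinv) (act\<^sub>1 (U_class p fK) ?S)"
      by (simp only: K[OF S] B.act_K_Kinv that)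
    then show ?thesis by (simp only: A.act_K_Kinv S)
  qed
  have E: "?eq GE T" if "T \<in> qdiff_ops p" for T
    using that by (rule induct) (simp_all only: A.act_letter_mult B.act_letter_mult K gen.distinct not_False_eq_True)
  have F: "?eq GF T" if "T \<in> qdiff_ops p" for T
    using that by (rule induct) (simp_all only: A.act_letter_mult B.act_letter_mult Kinv gen.distinct not_False_eq_True)
  have gen: "?eq g T" if "T \<in> qdiff_ops p" for g T
    using that by (cases g) (simp_all only: E F K Kinv)
  have word: "act\<^sub>1 (U_class p (Poly_Mapping.single w 1)) T = act\<^sub>2 (U_class p (Poly_Mapping.single w 1)) T" for w
  proof (induction w)
    case Nil
    show ?case by (simp only: A.act_empty_word B.act_empty_word T)
  next
    case (Cons g w)
    have *: "Poly_Mapping.single (g # w) 1 = letter g * Poly_Mapping.single w 1"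
      by (simp add: letter_def mult_single plus_list_def)
    show ?case
      unfolding * by (simp only: A.act_class_mult B.act_class_mult T Cons gen B.act_closed carr)
  qed
  obtain f where h: "h = U_class p f" using h by (auto simp: carrier_U)
  show ?thesis
    unfolding h
  proof (induction f rule: poly_mapping_add_induct)
    case (single w c)
    have *: "Poly_Mapping.single w c = scalar c * Poly_Mapping.single w 1"
      by (simp add: scalar_def mult_single)
    show ?case
      unfolding * by (simp only: A.act_class_mult B.act_class_mult T word A.act_scalar B.act_scalar B.act_closed carr)
  next
    case (add f g)
    then show ?case by (simp only: A.act_class_add B.act_class_add T)
  qed
qed

end

theorem lemma3p3:
  fixes p :: nat
  assumes "p \<ge> 2"
  shows "\<exists>act. U_module_algebra op_scale p (qdiff_ops p) (\<circ>) id act \<and> prescribed_action p act \<and>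
           (\<forall>act'. U_module_algebra op_scale p (qdiff_ops p) (\<circ>) id act' \<and> prescribed_action p act'
              \<longrightarrow> (\<forall>h \<in> carrier (U p). \<forall>T \<in> qdiff_ops p. act' h T = act h T))"
proof -
  interpret root_param p by unfold_locales (rule assms)
  show ?thesis
    using U_module_algebra_U_act prescribed_action_U_act U_action_unique by blast
qed

end
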